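(* Let $n\ge 3$ and let $\{f_{a,b}(x;\theta)\}$ be a one-parameter family of location-scale densities on $\mathbb{R}$ as described in the context, with $f(x;0)=\frac{1}{\sqrt{2\pi}}e^{-x^2/2}$ and with $\log f(x;\theta)$ continuously differentiable in $\theta\ge 0$ including the boundary $\theta=0$. Assume that for some $\epsilon>0$ $$\int_0^\infty\int_{-\infty}^\infty g(a,b;\epsilon)^n\exp\Big(-\frac{n(a^2+b^2)}{2}\Big)b^{n-2}\,da\,db<\infty,\qquad g(a,b;\epsilon)=\sup_{|z|\le\sqrt n,\;0\le\theta\le\epsilon}\frac{\left|\frac{\partial}{\partial\theta}f(a+bz;\theta)\right|}{f(a+bz;0)} .$$ Let $l_\theta(x;0)=\frac{\partial}{\partial\theta}\log f(x;\theta)\big|_{\theta=0}$ be the score function at $\theta=0$. (1) If $l_\theta(x;0)$ is a third degree polynomial in $x$, then the locally best invariant test of normality $H_0:\theta=0$ against $H_1:\theta>0$ is given by the standardized sample skewness $\tilde m_3=\frac1n\sum_{i=1}^n z_i^3$. (2) If $l_\theta(x;0)$ is a fourth degree polynomial in $x$ without odd degree terms, then the locally best invariant test of normality $H_0:\theta=0$ against $H_1:\theta>0$ is given by the standardized sample kurtosis $\tilde m_4=\frac1n\sum_{i=1}^n z_i^4$.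
   Context: For $\theta\ge 0$ let $f(\cdot;\theta)$ be a probability density on $\mathbb{R}$ and let $f_{a,b}(x;\theta)=\frac1b f\left(\frac{x-a}{b};\theta\right)$, $-\infty<a<\infty$, $b>0$, so that $f=f_{0,1}$. The value $\theta=0$ corresponds to the normal location-scale family. The observations $x_1,\dots,x_n$ are i.i.d. from $f_{a,b}(x;\theta)$ with $a,b,\theta$ unknown. The standardized observations are $z_i=(x_i-\bar x)/s$, where $\bar x=\frac1n\sum_j x_j$ and $s^2=\frac1n\sum_{j}(x_j-\bar x)^2$. A critical (rejection) region $R\subset\mathbb{R}^n$ is invariant if $(x_1,\dots,x_n)\in R\Leftrightarrow(a+bx_1,\dots,a+bx_n)\in R$ for all $a\in\mathbb{R}$, $b>0$; the probability $P_\theta(R)$ of an invariant region depends only on $\theta$, not on $(a,b)$. An invariant region $R$ is the rejection region of a locally best invariant (LBI) test (of size $P_0(R)$) if for every invariant region $R'$ with $P_0(R')\le P_0(R)$ there is $\theta_0>0$ such that $P_\theta(R)\ge P_\theta(R')$ for all $0<\theta<\theta_0$. "The LBI test is given by a statistic $S$" means that the one-sided threshold regions based on $S$ are rejection regions of LBI tests: the regions $\{S>c\}$ if the leading coefficient of the polynomial $l_\theta(x;0)$ is positive, and the regions $\{S<c\}$ if it is negative. *)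

theory Defs
  imports "HOL-Probability.Probability" "HOL-Computational_Algebra.Polynomial"
begin

text \<open>
  A parametric family of densities on the real line is a function of type
  \<open>real \<Rightarrow> real \<Rightarrow> real\<close>, where \<open>f x \<theta>\<close> stands for \<open>f(x; \<theta>)\<close>; only its values for
  \<open>\<theta> \<ge> 0\<close> matter.  A sample of size \<open>n = CARD('n)\<close> is a vector of type \<open>real^'n\<close>.
\<close>

definition loc_scale :: "(real \<Rightarrow> real \<Rightarrow> real) \<Rightarrow> real \<Rightarrow> real \<Rightarrow> real \<Rightarrow> real \<Rightarrow> real" where
  "loc_scale f a b x \<theta> = 1 / b * f ((x - a) / b) \<theta>"

text \<open>The derivative in \<open>\<theta> \<in> [0, \<infinity>)\<close>, which at the boundary point \<open>0\<close> is the right derivative.\<close>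

definition theta_deriv :: "(real \<Rightarrow> real) \<Rightarrow> real \<Rightarrow> real" where
  "theta_deriv h \<theta> = vector_derivative h (at \<theta> within {0..})"

text \<open>Positivity of the densities is implicit in speaking of \<open>log f\<close> as a real function.\<close>

definition smooth_density_family :: "(real \<Rightarrow> real \<Rightarrow> real) \<Rightarrow> bool" where
  "smooth_density_family f \<longleftrightarrow>
     (\<forall>\<theta>\<ge>0. (\<lambda>x. f x \<theta>) \<in> borel_measurable borel \<and> (\<forall>x. 0 < f x \<theta>) \<and>
            (\<integral>\<^sup>+x. ennreal (f x \<theta>) \<partial>lborel) = 1) \<and>
     (\<forall>x. (\<lambda>\<theta>. ln (f x \<theta>)) differentiable_on {0..} \<and>
          continuous_on {0..} (theta_deriv (\<lambda>\<theta>. ln (f x \<theta>))))"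

definition score0 :: "(real \<Rightarrow> real \<Rightarrow> real) \<Rightarrow> real \<Rightarrow> real" where
  "score0 f x = theta_deriv (\<lambda>\<theta>. ln (f x \<theta>)) 0"

text \<open>The dominating function \<open>g(a, b; \<epsilon>)\<close>, which may be infinite.\<close>

definition dom_fun :: "(real \<Rightarrow> real \<Rightarrow> real) \<Rightarrow> nat \<Rightarrow> real \<Rightarrow> real \<Rightarrow> real \<Rightarrow> ennreal" where
  "dom_fun f n \<epsilon> a b =
     (SUP (z, \<theta>) \<in> {z. \<bar>z\<bar> \<le> sqrt (real n)} \<times> {0..\<epsilon>}.
        ennreal (\<bar>theta_deriv (f (a + b * z)) \<theta>\<bar> / f (a + b * z) 0))"

text \<open>The law of an i.i.d. sample from the density \<open>f\<^sub>a\<^sub>,\<^sub>b(\<cdot>; \<theta>)\<close>.\<close>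

definition sample_law ::
  "(real \<Rightarrow> real \<Rightarrow> real) \<Rightarrow> real \<Rightarrow> real \<Rightarrow> real \<Rightarrow> (real^'n) measure" where
  "sample_law f a b \<theta> =
     distr (\<Pi>\<^sub>M i\<in>(UNIV :: 'n set). density lborel (\<lambda>x. ennreal (loc_scale f a b x \<theta>)))
           borel (\<lambda>x. \<chi> i. x i)"

definition invariant_region :: "(real^'n) set \<Rightarrow> bool" where
  "invariant_region R \<longleftrightarrow> R \<in> sets borel \<and>
     (\<forall>a b x. 0 < b \<longrightarrow> (x \<in> R \<longleftrightarrow> (\<chi> i. a + b * x $ i) \<in> R))"

text \<open>
  \<open>P\<^sub>\<theta>(R)\<close>, computed at \<open>(a, b) = (0, 1)\<close>; for invariant regions the choice of \<open>(a, b)\<close> is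
  irrelevant by \<open>prob_region_eq\<close> below.
\<close>

definition prob_region :: "(real \<Rightarrow> real \<Rightarrow> real) \<Rightarrow> real \<Rightarrow> (real^'n) set \<Rightarrow> real" where
  "prob_region f \<theta> R = measure (sample_law f 0 1 \<theta>) R"

definition lbi_region :: "(real \<Rightarrow> real \<Rightarrow> real) \<Rightarrow> (real^'n) set \<Rightarrow> bool" where
  "lbi_region f R \<longleftrightarrow> invariant_region R \<and>
     (\<forall>R' :: (real^'n) set. invariant_region R' \<and> prob_region f 0 R' \<le> prob_region f 0 R \<longrightarrow>
        (\<exists>\<theta>\<^sub>0>0. \<forall>\<theta>. 0 < \<theta> \<and> \<theta> < \<theta>\<^sub>0 \<longrightarrow> prob_region f \<theta> R' \<le> prob_region f \<theta> R))"

text \<open>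
  \<open>l\<close> is the score polynomial; the sign of its leading coefficient decides on which side of
  the threshold the statistic \<open>S\<close> rejects.
\<close>

definition lbi_test_given_by ::
  "(real \<Rightarrow> real \<Rightarrow> real) \<Rightarrow> real poly \<Rightarrow> (real^'n \<Rightarrow> real) \<Rightarrow> bool" where
  "lbi_test_given_by f l S \<longleftrightarrow>
     (\<forall>c. (0 < lead_coeff l \<longrightarrow> lbi_region f {x. S x > c}) \<and>
          (lead_coeff l < 0 \<longrightarrow> lbi_region f {x. S x < c}))"

definition sample_mean :: "real^'n \<Rightarrow> real" where
  "sample_mean x = (\<Sum>i\<in>UNIV. x $ i) / real CARD('n)"

definition sample_sd :: "real^'n \<Rightarrow> real" where
  "sample_sd x = sqrt ((\<Sum>i\<in>UNIV. (x $ i - sample_mean x)^2) / real CARD('n))"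

text \<open>
  On the null set of samples with all entries equal, division by zero makes every standardized
  observation zero, so that the moments below are invariant everywhere.
\<close>

definition standardized :: "real^'n \<Rightarrow> 'n \<Rightarrow> real" where
  "standardized x i = (x $ i - sample_mean x) / sample_sd x"

definition std_moment :: "nat \<Rightarrow> real^'n \<Rightarrow> real" where
  "std_moment k x = (\<Sum>i\<in>UNIV. standardized x i ^ k) / real CARD('n)"

abbreviation skewness :: "real^'n \<Rightarrow> real" where
  "skewness \<equiv> std_moment 3"

abbreviation kurtosis :: "real^'n \<Rightarrow> real" where
  "kurtosis \<equiv> std_moment 4"

lemma density_loc_scale:
  assumes [measurable]: "(\<lambda>x. f x \<theta>) \<in> borel_measurable borel" and "0 < b"
  shows "density lborel (\<lambda>x. ennreal (loc_scale f a b x \<theta>)) =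
         distr (density lborel (\<lambda>x. ennreal (f x \<theta>))) borel (\<lambda>x. a + b * x)"
proof (rule measure_eqI)
  fix A :: "real set"
  assume "A \<in> sets (density lborel (\<lambda>x. ennreal (loc_scale f a b x \<theta>)))"
  then have [measurable]: "A \<in> sets borel" by simp
  have m[measurable]: "(\<lambda>x. loc_scale f a b x \<theta>) \<in> borel_measurable borel"
    unfolding loc_scale_def by measurable
  have "emeasure (density lborel (\<lambda>x. ennreal (loc_scale f a b x \<theta>))) A =
        (\<integral>\<^sup>+x. ennreal (loc_scale f a b x \<theta>) * indicator A x \<partial>lborel)"
    by (simp add: emeasure_density)
  also have "\<dots> = b * (\<integral>\<^sup>+x. ennreal (loc_scale f a b (a + b * x) \<theta>) * indicator A (a + b * x) \<partial>lborel)"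
    using \<open>0 < b\<close> by (subst nn_integral_real_affine[where c = b and t = a]) auto
  also have "\<dots> = (\<integral>\<^sup>+x. ennreal b * (ennreal (loc_scale f a b (a + b * x) \<theta>) * indicator A (a + b * x)) \<partial>lborel)"
    by (subst nn_integral_cmult) auto
  also have "\<dots> = (\<integral>\<^sup>+x. ennreal (f x \<theta>) * indicator ((\<lambda>x. a + b * x) -` A) x \<partial>lborel)"
    using \<open>0 < b\<close>
    by (intro nn_integral_cong)
       (auto simp: loc_scale_def mult.assoc[symmetric] ennreal_mult'[symmetric] split: split_indicator)
  also have "\<dots> = emeasure (distr (density lborel (\<lambda>x. ennreal (f x \<theta>))) borel (\<lambda>x. a + b * x)) A"
  proof -
    have "(\<lambda>x. a + b * x) -` A \<in> sets borel"
      using measurable_sets[of "\<lambda>x. a + b * x" borel borel A] by simp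
    then show ?thesis by (subst emeasure_distr) (auto simp: emeasure_density)
  qed
  finally show "emeasure (density lborel (\<lambda>x. ennreal (loc_scale f a b x \<theta>))) A =
    emeasure (distr (density lborel (\<lambda>x. ennreal (f x \<theta>))) borel (\<lambda>x. a + b * x)) A" .
qed simp

lemma prob_region_eq:
  fixes R :: "(real^'n) set"
  assumes f: "smooth_density_family f" and R: "invariant_region R" and "0 \<le> \<theta>" "0 < b"
  shows "measure (sample_law f a b \<theta>) R = prob_region f \<theta> R"
proof -
  have fm: "(\<lambda>x. f x \<theta>) \<in> borel_measurable borel"
    and f1: "(\<integral>\<^sup>+x. ennreal (f x \<theta>) \<partial>lborel) = 1"
    using f \<open>0 \<le> \<theta>\<close> by (auto simp: smooth_density_family_def)
  let ?D = "density lborel (\<lambda>x. ennreal (f x \<theta>))"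
  let ?M = "\<Pi>\<^sub>M i\<in>(UNIV::'n set). ?D"
  let ?v = "\<lambda>x. (\<chi> i. x i) :: real^'n"
  interpret D: prob_space ?D
    by (rule prob_spaceI) (use fm f1 in \<open>simp add: emeasure_density\<close>)
  have v: "?v \<in> (\<Pi>\<^sub>M i\<in>(UNIV::'n set). M i) \<rightarrow>\<^sub>M borel"
    if "\<And>i. sets (M i) = sets borel" for M :: "'n \<Rightarrow> real measure"
  proof -
    have c: "(\<lambda>x. x i) \<in> (\<Pi>\<^sub>M i\<in>(UNIV::'n set). M i) \<rightarrow>\<^sub>M borel" for i
      by (subst measurable_cong_sets[OF refl that[of i, symmetric]]) simp
    show ?thesis
    proof (subst borel_measurable_iff_halfspace_le, safe)
      fix j :: "real^'n" and t :: real
      assume "j \<in> Basis"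
      then obtain i where j: "j = axis i 1" by (auto simp: Basis_vec_def)
      show "{w \<in> space (\<Pi>\<^sub>M i\<in>(UNIV::'n set). M i). ?v w \<bullet> j \<le> t} \<in> sets (\<Pi>\<^sub>M i\<in>(UNIV::'n set). M i)"
        using c[of i] by (simp add: j inner_axis borel_measurable_iff_le)
    qed
  qed
  have law: "sample_law f a b \<theta> = distr ?M borel (\<lambda>x. \<chi> i. a + b * x i)" if "0 < b" for a b
  proof -
    have am: "(\<lambda>x. a + b * x) \<in> ?D \<rightarrow>\<^sub>M ?D" by measurable
    have cm: "compose UNIV (\<lambda>x. a + b * x) \<in> ?M \<rightarrow>\<^sub>M ?M"
      unfolding compose_def
      by (intro measurable_restrict measurable_compose[OF _ am] measurable_component_singleton) simp
    have "distr ?D borel (\<lambda>x. a + b * x) = distr ?D ?D (\<lambda>x. a + b * x)"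
      by (rule distr_cong) auto
    then have "(\<Pi>\<^sub>M i\<in>(UNIV::'n set). distr ?D borel (\<lambda>x. a + b * x)) =
          distr ?M ?M (compose UNIV (\<lambda>x. a + b * x))"
      by (simp add: distr_PiM_finite_prob_space' D.prob_space_axioms am)
    then have "sample_law f a b \<theta> = distr (distr ?M ?M (compose UNIV (\<lambda>x. a + b * x))) borel ?v"
      by (simp add: sample_law_def density_loc_scale[where f = f and \<theta> = \<theta> and a = a, OF fm that])
    also have "\<dots> = distr ?M borel (?v \<circ> compose UNIV (\<lambda>x. a + b * x))"
      by (rule distr_distr[OF _ cm]) (use v in simp)
    finally show ?thesis by (simp add: comp_def compose_def restrict_def)
  qed
  have Rb: "R \<in> sets borel" using R by (simp add: invariant_region_def)
  have meas: "(\<lambda>x. \<chi> i. a + b * x i) \<in> ?M \<rightarrow>\<^sub>M (borel :: (real^'n) measure)" for a b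
  proof -
    have "(\<lambda>y :: real^'n. \<chi> i. a + b * y $ i) \<in> borel \<rightarrow>\<^sub>M borel"
      by (intro borel_measurable_continuous_onI continuous_intros)
    from measurable_compose[OF v[of "\<lambda>_. ?D"] this] show ?thesis by simp
  qed
  have "measure (sample_law f a b \<theta>) R = measure ?M ((\<lambda>x. \<chi> i. a + b * x i) -` R \<inter> space ?M)"
    if "0 < b" for a b
    using law[OF that] measure_distr[OF meas Rb] by simp
  moreover have "(\<lambda>x. \<chi> i. a + b * x i) -` R = ?v -` R" if "0 < b" for a b
  proof -
    have "?v x \<in> R \<longleftrightarrow> (\<chi> i. a + b * x i) \<in> R" for x
      using R[unfolded invariant_region_def, THEN conjunct2, rule_format, OF that, of "?v x" a] by simp
    then show ?thesis by auto
  qed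
  ultimately show ?thesis
    using \<open>0 < b\<close> by (simp add: prob_region_def)
qed

end

theory Submission
  imports Defs
begin

text \<open>
  The power of an invariant region \<open>R\<close> is compared with that of a competitor to first order in
  \<open>\<theta>\<close>.  The right derivative of \<open>P\<^sub>\<theta>(R)\<close> at \<open>0\<close> is \<open>E\<^sub>0[1\<^sub>R \<Sum> l(x\<^sub>i)]\<close>, where \<open>l\<close> is the score
  (\<open>prob_region_right_derivative\<close>).  Writing \<open>x\<^sub>i = m + s z\<^sub>i\<close> with sample mean \<open>m\<close> and standard
  deviation \<open>s\<close>, the pair \<open>(m, s)\<close> is independent under normality of every invariant event and
  statistic, so \<open>m\<close> and \<open>s\<close> can be averaged out.  For a cubic score there remains a multiple of the
  skewness, for an even quartic score a multiple of the kurtosis, with the sign of the leading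
  coefficient and up to a constant times \<open>P\<^sub>0(R)\<close> (\<open>expected_score_cubic\<close>,
  \<open>expected_score_even_quartic\<close>).  Thus the derivative is \<open>\<alpha> E\<^sub>0[1\<^sub>R S] + \<beta> P\<^sub>0(R)\<close>, and a
  Neyman-Pearson argument shows that threshold regions of \<open>S\<close> are locally best
  (\<open>lbi_region_superlevel\<close>).

  Two steps need the distribution of \<open>(m, s)\<close>: independence, and the translation of the integrability
  hypothesis, which is stated in the coordinates \<open>(a, b)\<close>, into a dominating function on sample
  space.  Both follow from \<open>invariant_region_disintegration\<close>: Lebesgue measure on an invariant region
  induces on \<open>(m, s)\<close> a constant multiple of \<open>s\<^sup>n\<^sup>-\<^sup>2 dm ds\<close>.  This holds without an
  explicit change of variables, because the affine symmetries of the region determine the induced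
  measure up to a constant, by an argument like the uniqueness of Haar measure.

  The likelihood ratio of each observation differs from \<open>1\<close> by at most \<open>\<theta> \<Gamma>\<close>, where \<open>\<Gamma>\<close> is the
  dominating function evaluated at \<open>(m, s)\<close>.  The difference quotient of the joint likelihood ratio is
  then at most \<open>(1 + \<epsilon> \<Gamma>)\<^sup>n / \<epsilon>\<close>, which is integrable because \<open>\<Gamma>\<^sup>n\<close> is
  (\<open>joint_density_quotient_bound\<close>, \<open>open_dom_fun_integrable\<close>).
\<close>

section \<open>Lebesgue measure on sample space and the law of a sample\<close>

lemma measurable_vec_lambda_PiM:
  assumes "\<And>i. sets (M i) = sets borel"
  shows "(\<lambda>x. (\<chi> i. x i) :: real^'n) \<in> (\<Pi>\<^sub>M i\<in>(UNIV::'n::finite set). M i) \<rightarrow>\<^sub>M borel"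
proof -
  have c: "(\<lambda>x. x i) \<in> (\<Pi>\<^sub>M i\<in>(UNIV::'n set). M i) \<rightarrow>\<^sub>M borel" for i
    by (subst measurable_cong_sets[OF refl assms[of i, symmetric]]) simp
  show ?thesis
  proof (subst borel_measurable_iff_halfspace_le, safe)
    fix j :: "real^'n" and t :: real
    assume "j \<in> Basis"
    then obtain i where j: "j = axis i 1" by (auto simp: Basis_vec_def)
    show "{w \<in> space (\<Pi>\<^sub>M i\<in>(UNIV::'n set). M i). ((\<chi> i. w i) :: real^'n) \<bullet> j \<le> t} \<in>
        sets (\<Pi>\<^sub>M i\<in>(UNIV::'n set). M i)"
      using c[of i] by (simp add: j inner_axis borel_measurable_iff_le)
  qed
qed

lemma borel_measurable_vec_nth [measurable (raw)]:
  fixes g :: "'a \<Rightarrow> real^'n::finite"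
  assumes "g \<in> M \<rightarrow>\<^sub>M borel"
  shows "(\<lambda>x. g x $ i) \<in> borel_measurable M"
  by (rule measurable_compose[OF assms]) (intro borel_measurable_continuous_onI continuous_intros)

lemma prod_Basis_vec:
  "(\<Prod>b\<in>(Basis :: (real^'n::finite) set). h b) = (\<Prod>i\<in>UNIV. h (axis i 1))"
proof -
  have B: "(Basis :: (real^'n) set) = (\<lambda>i. axis i 1) ` UNIV"
    by (auto simp: Basis_vec_def)
  have "inj_on (\<lambda>i. axis i 1 :: real^'n) UNIV"
    by (auto simp: inj_on_def axis_eq_axis)
  then show ?thesis unfolding B by (simp add: prod.reindex)
qed

lemma lborel_vec_eq_distr_PiM:
  "(lborel :: (real^'n::finite) measure) =
     distr (\<Pi>\<^sub>M i\<in>(UNIV::'n set). lborel) borel (\<lambda>x. \<chi> i. x i)"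
proof (rule lborel_eqI)
  fix l u :: "real^'n"
  assume le: "\<And>b. b \<in> Basis \<Longrightarrow> l \<bullet> b \<le> u \<bullet> b"
  have le': "l $ i \<le> u $ i" for i
    using le[of "axis i 1"] by (auto simp: Basis_vec_def inner_axis)
  interpret P: product_sigma_finite "\<lambda>_::'n. lborel :: real measure" ..
  have "emeasure (distr (\<Pi>\<^sub>M i\<in>(UNIV::'n set). lborel) borel (\<lambda>x. (\<chi> i. x i) :: real^'n)) (box l u) =
     emeasure (\<Pi>\<^sub>M i\<in>(UNIV::'n set). lborel) (\<Pi>\<^sub>E i\<in>UNIV. {l $ i<..<u $ i})"
    by (subst emeasure_distr)
       (auto simp: measurable_vec_lambda_PiM box_def Basis_vec_def inner_axis space_PiM
         intro!: arg_cong2[where f = emeasure])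
  also have "\<dots> = ennreal (\<Prod>i\<in>UNIV. u $ i - l $ i)"
    by (subst P.emeasure_PiM) (auto simp: le' prod_ennreal)
  finally show "emeasure (distr (\<Pi>\<^sub>M i\<in>(UNIV::'n set). lborel) borel
      (\<lambda>x. (\<chi> i. x i) :: real^'n)) (box l u) = (\<Prod>b\<in>Basis. (u - l) \<bullet> b)"
    by (simp add: prod_Basis_vec inner_axis)
qed simp

lemma nn_integral_lborel_vec_prod:
  fixes h :: "real \<Rightarrow> ennreal"
  assumes [measurable]: "h \<in> borel_measurable borel"
  shows "(\<integral>\<^sup>+x. (\<Prod>i\<in>UNIV. h (x $ i)) \<partial>(lborel :: (real^'n::finite) measure)) =
     (\<integral>\<^sup>+t. h t \<partial>lborel) ^ CARD('n)"
proof -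
  interpret P: product_sigma_finite "\<lambda>_::'n. lborel :: real measure" ..
  have "(\<integral>\<^sup>+x. (\<Prod>i\<in>UNIV. h (x $ i)) \<partial>(lborel :: (real^'n) measure)) =
     (\<integral>\<^sup>+x. (\<Prod>i\<in>UNIV. h (x i)) \<partial>(\<Pi>\<^sub>M i\<in>(UNIV::'n set). lborel))"
    by (subst lborel_vec_eq_distr_PiM, subst nn_integral_distr)
       (auto simp: measurable_vec_lambda_PiM)
  also have "\<dots> = (\<integral>\<^sup>+t. h t \<partial>lborel) ^ CARD('n)"
    by (subst P.product_nn_integral_prod) auto
  finally show ?thesis .
qed

definition joint_density :: "(real \<Rightarrow> real \<Rightarrow> real) \<Rightarrow> real \<Rightarrow> real^'n \<Rightarrow> real" where
  "joint_density f \<theta> x = (\<Prod>i\<in>UNIV. f (x $ i) \<theta>)"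

lemma borel_measurable_joint_density:
  assumes "(\<lambda>x. f x \<theta>) \<in> borel_measurable borel"
  shows "joint_density f \<theta> \<in> borel_measurable (borel :: (real^'n::finite) measure)"
proof -
  have [measurable]: "(\<lambda>x. f x \<theta>) \<in> borel_measurable borel" by fact
  show ?thesis unfolding joint_density_def[abs_def] by measurable
qed

text \<open>
  Working with one density on \<open>\<real>\<^sup>n\<close> per parameter, instead of a product of measures, allows the
  power of a region to be differentiated under the integral sign.
\<close>

lemma sample_law_eq_density:
  assumes [measurable]: "(\<lambda>x. f x \<theta>) \<in> borel_measurable borel" and nn: "\<And>x. 0 \<le> f x \<theta>"
    and f1: "(\<integral>\<^sup>+x. ennreal (f x \<theta>) \<partial>lborel) = 1"
  shows "(sample_law f 0 1 \<theta> :: (real^'n::finite) measure) = density lborel (joint_density f \<theta>)"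
proof -
  let ?D = "density lborel (\<lambda>x. ennreal (f x \<theta>))"
  let ?L = "\<Pi>\<^sub>M i\<in>(UNIV::'n set). (lborel :: real measure)"
  let ?v = "\<lambda>x. (\<chi> i. x i) :: real^'n"
  interpret P: product_sigma_finite "\<lambda>_::'n. lborel :: real measure" ..
  interpret D: prob_space ?D
    by (rule prob_spaceI) (use f1 in \<open>simp add: emeasure_density\<close>)
  interpret Q: product_sigma_finite "\<lambda>_::'n. ?D" ..
  have [measurable]: "?v \<in> ?L \<rightarrow>\<^sub>M borel" by (rule measurable_vec_lambda_PiM) simp
  have [measurable]: "joint_density f \<theta> \<in> borel_measurable (borel :: (real^'n) measure)"
    by (rule borel_measurable_joint_density) fact
  have "density ?L (\<lambda>x. joint_density f \<theta> (?v x)) = (\<Pi>\<^sub>M i\<in>(UNIV::'n set). ?D)"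
  proof (rule Q.PiM_eqI)
    fix A :: "'n \<Rightarrow> real set"
    assume "\<And>i. i \<in> UNIV \<Longrightarrow> A i \<in> sets ?D"
    then have [measurable]: "A i \<in> sets borel" for i by simp
    have [measurable]: "Pi\<^sub>E UNIV A \<in> sets ?L" by (rule sets_PiM_I_finite) auto
    have "emeasure (density ?L (\<lambda>x. joint_density f \<theta> (?v x))) (Pi\<^sub>E UNIV A) =
       (\<integral>\<^sup>+x. ennreal (joint_density f \<theta> (?v x)) * indicator (Pi\<^sub>E UNIV A) x \<partial>?L)"
      by (subst emeasure_density) auto
    also have "\<dots> = (\<integral>\<^sup>+x. (\<Prod>i\<in>UNIV. ennreal (f (x i) \<theta>) * indicator (A i) (x i)) \<partial>?L)"
    proof (rule nn_integral_cong)
      fix x :: "'n \<Rightarrow> real"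
      have "(indicator (Pi\<^sub>E UNIV A) x :: ennreal) = (\<Prod>i\<in>UNIV. indicator (A i) (x i))"
        by (auto simp: indicator_def PiE_def Pi_def extensional_def prod_zero_iff) 
      then show "ennreal (joint_density f \<theta> (?v x)) * indicator (Pi\<^sub>E UNIV A) x =
          (\<Prod>i\<in>UNIV. ennreal (f (x i) \<theta>) * indicator (A i) (x i))"
        by (simp add: joint_density_def prod_ennreal[symmetric] nn prod.distrib)
    qed
    also have "\<dots> = (\<Prod>i\<in>UNIV. \<integral>\<^sup>+t. ennreal (f t \<theta>) * indicator (A i) t \<partial>lborel)"
      by (subst P.product_nn_integral_prod) auto
    also have "\<dots> = (\<Prod>i\<in>UNIV. emeasure ?D (A i))"
      by (simp add: emeasure_density)
    finally show "emeasure (density ?L (\<lambda>x. joint_density f \<theta> (?v x))) (Pi\<^sub>E UNIV A) =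
       (\<Prod>i\<in>UNIV. emeasure ?D (A i))" .
  qed (auto intro!: sets_PiM_cong)
  then have "(sample_law f 0 1 \<theta> :: (real^'n) measure) =
      distr (density ?L (\<lambda>x. joint_density f \<theta> (?v x))) borel ?v"
    by (simp add: sample_law_def loc_scale_def)
  also have "\<dots> = density (distr ?L borel ?v) (joint_density f \<theta>)"
    by (subst density_distr) auto
  finally show ?thesis by (simp add: lborel_vec_eq_distr_PiM[symmetric])
qed

lemma nn_integral_lborel_affine:
  fixes t :: "'a::euclidean_space" and F :: "'a \<Rightarrow> ennreal"
  assumes [measurable]: "F \<in> borel_measurable borel" and "c \<noteq> 0"
  shows "(\<integral>\<^sup>+x. F x \<partial>lborel) = ennreal (\<bar>c\<bar> ^ DIM('a)) * (\<integral>\<^sup>+x. F (t + c *\<^sub>R x) \<partial>lborel)"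
  by (subst lborel_affine[OF \<open>c \<noteq> 0\<close>, of t])
     (simp add: nn_integral_density nn_integral_distr nn_integral_cmult)

section \<open>Polar disintegration along sample mean and standard deviation\<close>

lemma borel_measurable_sample_mean [measurable]:
  "sample_mean \<in> borel_measurable (borel :: (real^'n::finite) measure)"
  unfolding sample_mean_def[abs_def] by measurable

lemma borel_measurable_sample_sd [measurable]:
  "sample_sd \<in> borel_measurable (borel :: (real^'n::finite) measure)"
  unfolding sample_sd_def[abs_def] by measurable

lemma sample_mean_affine:
  "sample_mean (\<chi> i. a + b * x $ i) = a + b * sample_mean (x :: real^'n::finite)"
  by (simp add: sample_mean_def sum.distrib sum_distrib_left[symmetric] field_simps)

lemma sample_sd_affine:
  "sample_sd (\<chi> i. a + b * x $ i) = \<bar>b\<bar> * sample_sd (x :: real^'n::finite)"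
proof -
  have "(\<Sum>i\<in>UNIV. (a + b * x $ i - (a + b * sample_mean x))\<^sup>2) =
      b\<^sup>2 * (\<Sum>i\<in>UNIV. (x $ i - sample_mean x)\<^sup>2)"
    by (simp add: sum_distrib_left power_mult_distrib[symmetric] algebra_simps)
  then have "sample_sd (\<chi> i. a + b * x $ i) =
      sqrt (b\<^sup>2 * ((\<Sum>i\<in>UNIV. (x $ i - sample_mean x)\<^sup>2) / real CARD('n)))"
    unfolding sample_sd_def sample_mean_affine by simp
  then show ?thesis unfolding sample_sd_def real_sqrt_mult by simp
qed

lemma sample_sd_nonneg: "0 \<le> sample_sd x"
  by (simp add: sample_sd_def sum_nonneg)

lemma sum_deviations: "(\<Sum>i\<in>UNIV. x $ i - sample_mean x) = 0" for x :: "real^'n::finite"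
  by (simp add: sum_subtractf sample_mean_def)

lemma sum_deviations_square:
  "(\<Sum>i\<in>UNIV. (x $ i - sample_mean x)\<^sup>2) = real CARD('n) * (sample_sd x)\<^sup>2"
  for x :: "real^'n::finite"
  by (simp add: sample_sd_def sum_nonneg)

lemma sum_squares_mean_sd:
  "(\<Sum>i\<in>UNIV. (x $ i)\<^sup>2) = real CARD('n) * ((sample_mean x)\<^sup>2 + (sample_sd x)\<^sup>2)"
  for x :: "real^'n::finite"
proof -
  have "(\<Sum>i\<in>UNIV. (x $ i)\<^sup>2) =
      (\<Sum>i\<in>UNIV. (x $ i - sample_mean x)\<^sup>2 + 2 * sample_mean x * (x $ i - sample_mean x) + (sample_mean x)\<^sup>2)"
    by (intro sum.cong) (auto simp: power2_eq_square algebra_simps)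
  also have "\<dots> = real CARD('n) * (sample_sd x)\<^sup>2 + real CARD('n) * (sample_mean x)\<^sup>2"
    by (simp add: sum.distrib sum_deviations_square sum_distrib_left[symmetric] sum_deviations)
  finally show ?thesis by (simp add: algebra_simps)
qed

lemma norm_vec_mean_sd:
  "(norm x)\<^sup>2 = real CARD('n) * ((sample_mean x)\<^sup>2 + (sample_sd x)\<^sup>2)" for x :: "real^'n::finite"
  unfolding sum_squares_mean_sd[symmetric] norm_vec_def L2_set_def
  by (simp add: sum_nonneg)

text \<open>
  Samples without spread lie on a hyperplane \<open>x\<^sub>i = x\<^sub>j\<close>.
\<close>

lemma AE_sample_sd_pos:
  assumes "2 \<le> CARD('n::finite)"
  shows "AE x in (lborel :: (real^'n) measure). 0 < sample_sd x"
proof -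
  obtain i j :: 'n where "i \<noteq> j"
    using assms by (metis card_2_iff' card_le_Suc0_iff_eq finite not_less_eq_eq numeral_2_eq_2 UNIV_I)
  then have ne: "axis i (1::real) - axis j 1 \<noteq> (0 :: real^'n)"
    by (auto simp: axis_eq_axis)
  have sub: "{x :: real^'n. sample_sd x = 0} \<subseteq> {x. (axis i 1 - axis j 1) \<bullet> x = 0}"
  proof safe
    fix x :: "real^'n" assume "sample_sd x = 0"
    then have "(\<Sum>i\<in>UNIV. (x $ i - sample_mean x)\<^sup>2) = 0"
      using sum_deviations_square[of x] by simp
    then have "\<forall>i\<in>UNIV. (x $ i - sample_mean x)\<^sup>2 = 0"
      by (subst (asm) sum_nonneg_eq_0_iff) auto
    then have "x $ i = x $ j" by auto
    then show "(axis i 1 - axis j 1) \<bullet> x = 0"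
      by (simp add: inner_diff_left inner_axis')
  qed
  have "negligible {x :: real^'n. sample_sd x = 0}"
    by (rule negligible_subset[OF negligible_hyperplane sub]) (use ne in simp)
  then have "{x :: real^'n. sample_sd x = 0} \<in> null_sets lebesgue"
    by (simp add: negligible_iff_null_sets)
  then have "AE x in (lebesgue :: (real^'n) measure). \<not> sample_sd x = 0"
    by (rule AE_I'[of "{x. sample_sd x = 0}"]) auto
  then have "AE x in (lborel :: (real^'n) measure). \<not> sample_sd x = 0"
    by (simp add: AE_completion_iff)
  then show ?thesis
    by eventually_elim (use sample_sd_nonneg in \<open>auto simp: less_le\<close>)
qed

lemma invariant_region_borel: "invariant_region R \<Longrightarrow> R \<in> sets borel"
  by (simp add: invariant_region_def)

text \<open>
  The substitution \<open>x \<mapsto> a + r x\<close> leaves an invariant region unchanged, acts on \<open>(mean, sd)\<close> as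
  \<open>(m, s) \<mapsto> (a + r m, r s)\<close>, and multiplies Lebesgue measure by \<open>r\<^sup>n\<close>.  These symmetries
  determine the measure that Lebesgue measure on the region induces on \<open>(mean, sd)\<close>, up to a factor.
\<close>

lemma nn_integral_invariant_affine:
  fixes R :: "(real^'n::finite) set" and G :: "real \<Rightarrow> real \<Rightarrow> ennreal"
  assumes R: "invariant_region R" and "0 < r"
    and [measurable]: "case_prod G \<in> borel_measurable (borel \<Otimes>\<^sub>M borel)"
  shows "(\<integral>\<^sup>+x. indicator R x * G (sample_mean x) (sample_sd x) \<partial>lborel) =
    ennreal (r ^ CARD('n)) *
    (\<integral>\<^sup>+x. indicator R x * G (a + r * sample_mean x) (r * sample_sd x) \<partial>lborel)"
proof -
  have [measurable]: "R \<in> sets borel" using R by (rule invariant_region_borel)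
  have eq: "(\<chi> i. a) + r *\<^sub>R x = (\<chi> i. a + r * x $ i)" for x :: "real^'n"
    by (simp add: vec_eq_iff)
  have "(\<chi> i. a + r * x $ i) \<in> R \<longleftrightarrow> x \<in> R" for x
    using R[unfolded invariant_region_def, THEN conjunct2, rule_format, OF \<open>0 < r\<close>, of x a] by simp
  then have "(indicator R (\<chi> i. a + r * x $ i) :: ennreal) = indicator R x" for x
    by (simp add: indicator_def)
  then show ?thesis
    by (subst nn_integral_lborel_affine[where c = r and t = "\<chi> i. a"])
       (use \<open>0 < r\<close> in \<open>auto simp: eq sample_mean_affine sample_sd_affine\<close>)
qed

text \<open>
  For fixed \<open>B\<close> the left-hand side is a translation invariant measure of \<open>A\<close>, hence a multiple of
  Lebesgue measure.  The proof is the classical uniqueness argument for Haar measure: average over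
  all translations by \<open>t \<in> [0, 1]\<close> and exchange the order of integration.  Both integrals that are
  exchanged are Lebesgue integrals, so the induced measure may be infinite.
\<close>

lemma nn_integral_mean_translation:
  fixes R :: "(real^'n::finite) set"
  assumes R: "invariant_region R" and [measurable]: "A \<in> sets borel" "B \<in> sets borel"
  shows "(\<integral>\<^sup>+x. indicator R x * (indicator A (sample_mean x) * indicator B (sample_sd x)) \<partial>lborel) =
    emeasure lborel A *
    (\<integral>\<^sup>+x. indicator R x * (indicator {0..1} (sample_mean x) * indicator B (sample_sd x)) \<partial>lborel)"
    (is "?L = _ * ?E")
proof -
  have [measurable]: "R \<in> sets borel" using R by (rule invariant_region_borel)
  let ?I = "indicator {0..1::real} :: real \<Rightarrow> ennreal"
  have L: "?L = (\<integral>\<^sup>+x. indicator R x * (indicator A (t + 1 * sample_mean x) * indicator B (1 * sample_sd x)) \<partial>lborel)" for t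
    using nn_integral_invariant_affine[OF R, of 1 "\<lambda>m s. indicator A m * indicator B s" t] by simp
  have "?L = (\<integral>\<^sup>+t. ?I t * ?L \<partial>lborel)"
    by (subst nn_integral_multc) auto
  also have "\<dots> = (\<integral>\<^sup>+t. (\<integral>\<^sup>+x. ?I t * (indicator R x * (indicator A (t + sample_mean x) * indicator B (sample_sd x))) \<partial>lborel) \<partial>lborel)"
  proof (rule nn_integral_cong)
    fix t :: real
    show "?I t * ?L = (\<integral>\<^sup>+x. ?I t * (indicator R x * (indicator A (t + sample_mean x) * indicator B (sample_sd x))) \<partial>lborel)"
      by (subst L[of t], subst nn_integral_cmult) auto
  qed
  also have "\<dots> = (\<integral>\<^sup>+x. (\<integral>\<^sup>+t. ?I t * (indicator R x * (indicator A (t + sample_mean x) * indicator B (sample_sd x))) \<partial>lborel) \<partial>lborel)"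
    by (rule lborel_pair.Fubini') measurable
  also have "\<dots> = (\<integral>\<^sup>+x. (\<integral>\<^sup>+u. ?I (u - sample_mean x) * (indicator R x * (indicator A u * indicator B (sample_sd x))) \<partial>lborel) \<partial>lborel)"
  proof (rule nn_integral_cong)
    fix x :: "real^'n"
    show "(\<integral>\<^sup>+t. ?I t * (indicator R x * (indicator A (t + sample_mean x) * indicator B (sample_sd x))) \<partial>lborel) =
      (\<integral>\<^sup>+u. ?I (u - sample_mean x) * (indicator R x * (indicator A u * indicator B (sample_sd x))) \<partial>lborel)"
      by (subst (2) nn_integral_real_affine[where c = 1 and t = "sample_mean x"])
         (auto simp: add.commute)
  qed
  also have "\<dots> = (\<integral>\<^sup>+u. (\<integral>\<^sup>+x. ?I (u - sample_mean x) * (indicator R x * (indicator A u * indicator B (sample_sd x))) \<partial>lborel) \<partial>lborel)"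
    by (rule lborel_pair.Fubini'[symmetric]) measurable
  also have "\<dots> = (\<integral>\<^sup>+u. indicator A u * ?E \<partial>lborel)"
  proof (rule nn_integral_cong)
    fix u :: real
    have "(\<integral>\<^sup>+x. ?I (u - sample_mean x) * (indicator R x * (indicator A u * indicator B (sample_sd x))) \<partial>lborel) =
      indicator A u * (\<integral>\<^sup>+x. indicator R x * (?I (u - sample_mean x) * indicator B (sample_sd x)) \<partial>lborel)"
      by (subst nn_integral_cmult[symmetric]) (auto simp: ac_simps)
    also have "(\<integral>\<^sup>+x. indicator R x * (?I (u - sample_mean x) * indicator B (sample_sd x)) \<partial>lborel) =
      (\<integral>\<^sup>+x. indicator R x * (?I (1 - sample_mean x) * indicator B (sample_sd x)) \<partial>lborel)"
      using nn_integral_invariant_affine[OF R, of 1 "\<lambda>m s. ?I (u - m) * indicator B s" "u - 1"] by simp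
    also have "\<dots> = ?E"
      by (intro nn_integral_cong) (auto simp: indicator_def)
    finally show "(\<integral>\<^sup>+x. ?I (u - sample_mean x) * (indicator R x * (indicator A u * indicator B (sample_sd x))) \<partial>lborel) =
      indicator A u * ?E" .
  qed
  also have "\<dots> = emeasure lborel A * ?E"
    by (subst nn_integral_multc) auto
  finally show ?thesis .
qed

lemma nn_integral_power_atMost:
  assumes "0 \<le> r"
  shows "(\<integral>\<^sup>+b. ennreal (b ^ k) * indicator {0<..} b * indicator {..r} b \<partial>lborel) =
    ennreal (r ^ (k + 1) / real (k + 1))"
proof -
  have "(\<integral>\<^sup>+b. ennreal (b ^ k) * indicator {0<..} b * indicator {..r} b \<partial>lborel) =
     (\<integral>\<^sup>+b. ennreal (b ^ k) * indicator {0..r} b \<partial>lborel)"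
    by (intro nn_integral_cong_AE, use AE_lborel_singleton[of "0::real"] in eventually_elim)
       (auto simp: indicator_def)
  also have "\<dots> = ennreal (r ^ (k + 1) / real (k + 1) - 0 ^ (k + 1) / real (k + 1))"
  proof (rule nn_integral_FTC_Icc)
    fix x :: real
    assume "x \<in> {0..r}"
    have "real (k + 1) \<noteq> 0" by simp
    then show "((\<lambda>x. x ^ (k + 1) / real (k + 1)) has_real_derivative x ^ k) (at x)"
      by (auto intro!: derivative_eq_intros) (cases k; auto simp: field_simps)
  qed (use assms in auto)
  finally show ?thesis by simp
qed

text \<open>
  Scaling by \<open>r\<close> shows that the mass \<open>\<kappa>\<close> of \<open>{mean \<in> [0, 1], sd \<le> r}\<close> is \<open>r\<^sup>n\<^sup>-\<^sup>1\<close> times the mass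
  of \<open>{mean \<in> [0, 1], sd \<le> 1}\<close>: the factor \<open>r\<^sup>n\<close> of Lebesgue measure is reduced by the factor
  \<open>1/r\<close> from rescaling the interval of the mean.  Differentiating in \<open>r\<close> gives the density \<open>b\<^sup>n\<^sup>-\<^sup>2\<close>.
\<close>

lemma invariant_region_sd_law:
  fixes R :: "(real^'n::finite) set"
  assumes n: "2 \<le> CARD('n)" and R: "invariant_region R"
  obtains K :: real where "0 \<le> K"
    and "distr (density lborel (\<lambda>x. indicator R x * indicator {0..1} (sample_mean x))) borel sample_sd =
      density lborel (\<lambda>b. ennreal K * (ennreal (b ^ (CARD('n) - 2)) * indicator {0<..} b))"
proof -
  have [measurable]: "R \<in> sets borel" using R by (rule invariant_region_borel)
  let ?n = "CARD('n)"
  define \<kappa> where "\<kappa> B = (\<integral>\<^sup>+x. indicator R x * (indicator {0..1::real} (sample_mean x) * indicator B (sample_sd x))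
    \<partial>(lborel :: (real^'n) measure))" for B
  \<comment> \<open>bounded mean and standard deviation bound the norm of the sample\<close>
  have fin: "\<kappa> {..1} < \<infinity>"
  proof -
    have "\<kappa> {..1} \<le> (\<integral>\<^sup>+x. indicator (cball 0 (sqrt (2 * ?n))) x \<partial>(lborel :: (real^'n) measure))"
      unfolding \<kappa>_def
    proof (rule nn_integral_mono)
      fix x :: "real^'n"
      show "indicator R x * (indicator {0..1} (sample_mean x) * indicator {..1} (sample_sd x))
        \<le> (indicator (cball 0 (sqrt (2 * ?n))) x :: ennreal)"
      proof (cases "x \<in> R \<and> sample_mean x \<in> {0..1} \<and> sample_sd x \<le> 1")
        case True
        then have "(norm x)\<^sup>2 \<le> real ?n * (1\<^sup>2 + 1\<^sup>2)"
          unfolding norm_vec_mean_sd using sample_sd_nonneg[of x]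
          by (intro mult_left_mono add_mono power_mono) auto
        then have "norm x \<le> sqrt (2 * ?n)" by (intro real_le_rsqrt) simp
        then show ?thesis by (auto simp: indicator_def)
      qed (auto simp: indicator_def)
    qed
    also have "\<dots> = emeasure lborel (cball (0 :: real^'n) (sqrt (2 * ?n)))" by simp
    also have "\<dots> < \<infinity>" by (intro emeasure_bounded_finite bounded_cball)
    finally show ?thesis .
  qed
  define C where "C = enn2real (\<kappa> {..1})"
  have C: "\<kappa> {..1} = ennreal C" "0 \<le> C" using fin by (auto simp: C_def)
  have scale: "\<kappa> {..r} = ennreal (C * r ^ (?n - 1))" if "0 < r" for r
  proof -
    have "\<kappa> {..r} = ennreal (r ^ ?n) * (\<integral>\<^sup>+x. indicator R x * (indicator {0..1::real} (0 + r * sample_mean x) *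
        indicator {..r} (r * sample_sd x)) \<partial>(lborel :: (real^'n) measure))"
      unfolding \<kappa>_def by (rule nn_integral_invariant_affine[OF R that]) measurable
    also have "(\<integral>\<^sup>+x. indicator R x * (indicator {0..1::real} (0 + r * sample_mean x) *
        indicator {..r} (r * sample_sd x)) \<partial>(lborel :: (real^'n) measure)) =
      (\<integral>\<^sup>+x. indicator R x * (indicator {0..1 / r} (sample_mean x) *
        indicator {..1} (sample_sd x)) \<partial>(lborel :: (real^'n) measure))"
      using that
      by (intro nn_integral_cong arg_cong2[where f = "(*)"] refl)
         (auto simp: indicator_def field_simps zero_le_mult_iff)
    also have "\<dots> = emeasure lborel {0..1 / r} * \<kappa> {..1}"
      unfolding \<kappa>_def by (rule nn_integral_mean_translation[OF R]) auto
    also have "\<dots> = ennreal (1 / r * C)" using that C by (simp add: ennreal_mult[symmetric])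
    also have "ennreal (r ^ ?n) * ennreal (1 / r * C) = ennreal (r ^ ?n * (1 / r * C))"
      using that C by (simp add: ennreal_mult[symmetric])
    also have "r ^ ?n = r ^ (?n - 1) * r"
      using n by (cases "?n") auto
    finally show ?thesis using that by (simp add: field_simps)
  qed
  have zero: "\<kappa> {..r} = 0" if "r \<le> 0" for r
  proof -
    have "\<kappa> {..r} = (\<integral>\<^sup>+x. 0 \<partial>(lborel :: (real^'n) measure))"
      unfolding \<kappa>_def
      by (intro nn_integral_cong_AE, use AE_sample_sd_pos[OF n] in eventually_elim)
         (use that in \<open>auto simp: indicator_def\<close>)
    then show ?thesis by simp
  qed
  let ?K = "C * real (?n - 1)"
  let ?M = "distr (density lborel (\<lambda>x::real^'n. indicator R x * indicator {0..1::real} (sample_mean x))) borel sample_sd :: real measure"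
  let ?N = "density lborel (\<lambda>b. ennreal ?K * (ennreal (b ^ (?n - 2)) * indicator {0<..} b)) :: real measure"
  have M: "emeasure ?M {..r} = \<kappa> {..r}" for r
  proof -
    have "emeasure ?M {..r} = (\<integral>\<^sup>+x. indicator {..r} x \<partial>?M)" by simp
    also have "\<dots> = \<kappa> {..r}"
      by (subst nn_integral_distr) (auto simp: nn_integral_density \<kappa>_def mult.assoc)
    finally show ?thesis .
  qed
  have N: "emeasure ?N {..r} = \<kappa> {..r}" for r
  proof -
    have "emeasure ?N {..r} =
       (\<integral>\<^sup>+b. ennreal ?K * (ennreal (b ^ (?n - 2)) * indicator {0<..} b * indicator {..r} b) \<partial>lborel)"
      by (subst emeasure_density) (auto simp: mult.assoc)
    also have "\<dots> = ennreal ?K * (\<integral>\<^sup>+b. (ennreal (b ^ (?n - 2)) * indicator {0<..} b * indicator {..r} b) \<partial>lborel)"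
      by (rule nn_integral_cmult) auto
    finally have *: "emeasure ?N {..r} = \<dots>" .
    show ?thesis
    proof (cases "0 < r")
      case True
      have n1: "?n - 2 + 1 = ?n - 1" using n by simp
      have "emeasure ?N {..r} = ennreal ?K * ennreal (r ^ (?n - 1) / real (?n - 1))"
        unfolding * using nn_integral_power_atMost[of r "?n - 2"] True unfolding n1 by simp
      also have "\<dots> = ennreal (?K * (r ^ (?n - 1) / real (?n - 1)))"
        by (rule ennreal_mult[symmetric]) (use True C in auto)
      also have "?K * (r ^ (?n - 1) / real (?n - 1)) = C * r ^ (?n - 1)"
        using n by simp
      finally show ?thesis using scale[OF True] by simp
    next
      case False
      then have "(\<lambda>b. ennreal (b ^ (?n - 2)) * indicator {0<..} b * indicator {..r} b) = (\<lambda>_. 0)"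
        by (auto simp: indicator_def fun_eq_iff)
      then show ?thesis unfolding * using zero[of r] False by simp
    qed
  qed
  have "?M = ?N"
  proof (rule measure_eqI_generator_eq[where E = "range atMost" and \<Omega> = UNIV and A = "\<lambda>i. {..real i}"])
    show "Int_stable (range atMost :: real set set)"
      by (auto simp: Int_stable_def)
    show "emeasure ?M X = emeasure ?N X" if "X \<in> range atMost" for X
      using that M N by auto
    show "sets ?M = sigma_sets UNIV (range atMost)" "sets ?N = sigma_sets UNIV (range atMost)"
      by (simp_all add: borel_eq_atMost)
    show "(\<Union>i. {..real i}) = UNIV"
      using real_arch_simple by auto
    show "emeasure ?M {..real i} \<noteq> \<infinity>" for i
      unfolding M using scale[of "real i"] zero[of "real i"] by (cases "i = 0") auto
  qed auto
  then show ?thesis using C(2) by (intro that[of ?K]) auto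
qed

text \<open>
  Polar coordinates \<open>x = a + b z\<close> restricted to an invariant region: the measure induced on
  \<open>(a, b)\<close> is \<open>b\<^sup>n\<^sup>-\<^sup>2 da db\<close> whatever the region is, which enters only through the constant \<open>K\<close>.
  Because a positive function of \<open>(a, b)\<close> can be chosen freely, this contains both the change of
  variables behind the integrability hypothesis and the independence of \<open>(mean, sd)\<close> from the
  standardized observations under normality.
\<close>

lemma invariant_region_disintegration:
  fixes R :: "(real^'n::finite) set"
  assumes n: "2 \<le> CARD('n)" and R: "invariant_region R"
  obtains K :: real where "0 \<le> K"
    and "\<And>F. case_prod F \<in> borel_measurable (borel \<Otimes>\<^sub>M borel) \<Longrightarrow>
      (\<integral>\<^sup>+x. indicator R x * F (sample_mean x) (sample_sd x) \<partial>lborel) =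
      ennreal K * (\<integral>\<^sup>+b. (\<integral>\<^sup>+a. F a b * (ennreal (b ^ (CARD('n) - 2)) * indicator {0<..} b) \<partial>lborel) \<partial>lborel)"
proof -
  have [measurable]: "R \<in> sets borel" using R by (rule invariant_region_borel)
  let ?d = "\<lambda>b::real. ennreal (b ^ (CARD('n) - 2)) * indicator {0<..} b"
  obtain K where K: "0 \<le> K"
    and law: "distr (density lborel (\<lambda>x. indicator R x * indicator {0..1} (sample_mean x))) borel sample_sd =
      density lborel (\<lambda>b. ennreal K * ?d b)"
    using invariant_region_sd_law[OF n R] by blast
  let ?\<nu> = "density lborel (\<lambda>b. ennreal K * ?d b)"
  let ?N = "distr (density lborel (indicator R)) (borel \<Otimes>\<^sub>M borel) (\<lambda>x. (sample_mean x, sample_sd x))"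
  have \<nu>: "sigma_finite_measure ?\<nu>"
    by (subst sigma_finite_measure.sigma_finite_iff_density_finite)
       (auto simp: sigma_finite_lborel indicator_def ennreal_mult_eq_top_iff)
  have eq: "lborel \<Otimes>\<^sub>M ?\<nu> = ?N"
  proof (rule pair_measure_eqI[OF sigma_finite_lborel \<nu>])
    fix A B :: "real set"
    assume "A \<in> sets lborel" "B \<in> sets ?\<nu>"
    then have [measurable]: "A \<in> sets borel" "B \<in> sets borel" by auto
    have "emeasure ?N (A \<times> B) = (\<integral>\<^sup>+x. indicator (A \<times> B) x \<partial>?N)" by simp
    also have "\<dots> = (\<integral>\<^sup>+x. indicator R x * (indicator A (sample_mean x) * indicator B (sample_sd x)) \<partial>lborel)"
      by (subst nn_integral_distr) (auto simp: nn_integral_density indicator_times)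
    also have "\<dots> = emeasure lborel A *
      (\<integral>\<^sup>+x. indicator R x * (indicator {0..1} (sample_mean x) * indicator B (sample_sd x)) \<partial>lborel)"
      by (rule nn_integral_mean_translation[OF R]) auto
    also have "(\<integral>\<^sup>+x. indicator R x * (indicator {0..1} (sample_mean x) * indicator B (sample_sd x)) \<partial>lborel) =
      (\<integral>\<^sup>+x. indicator B x \<partial>(distr (density lborel (\<lambda>x. indicator R x * indicator {0..1} (sample_mean x))) borel sample_sd))"
      by (subst nn_integral_distr) (auto simp: nn_integral_density mult.assoc)
    also have "\<dots> = emeasure ?\<nu> B" unfolding law by simp
    finally show "emeasure lborel A * emeasure ?\<nu> B = emeasure ?N (A \<times> B)" by simp
  qed (auto intro!: sets_pair_measure_cong)
  show ?thesis
  proof (rule that[OF K])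
    fix F :: "real \<Rightarrow> real \<Rightarrow> ennreal"
    assume [measurable]: "case_prod F \<in> borel_measurable (borel \<Otimes>\<^sub>M borel)"
    interpret \<nu>: sigma_finite_measure ?\<nu> by (rule \<nu>)
    interpret pair_sigma_finite lborel ?\<nu> ..
    have mF: "case_prod F \<in> borel_measurable (lborel \<Otimes>\<^sub>M ?\<nu>)"
      by (subst measurable_cong_sets[OF sets_pair_measure_cong[OF sets_lborel sets_density] refl]) simp
    have "(\<integral>\<^sup>+x. indicator R x * F (sample_mean x) (sample_sd x) \<partial>lborel) = (\<integral>\<^sup>+p. case_prod F p \<partial>?N)"
      by (subst nn_integral_distr) (auto simp: nn_integral_density)
    also have "\<dots> = (\<integral>\<^sup>+p. case_prod F p \<partial>(lborel \<Otimes>\<^sub>M ?\<nu>))" unfolding eq ..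
    also have "\<dots> = (\<integral>\<^sup>+b. (\<integral>\<^sup>+a. F a b \<partial>lborel) \<partial>?\<nu>)"
      using nn_integral_snd[OF mF] by simp
    also have "\<dots> = (\<integral>\<^sup>+b. ennreal K * (\<integral>\<^sup>+a. F a b * ?d b \<partial>lborel) \<partial>lborel)"
    proof (subst nn_integral_density, measurable, rule nn_integral_cong)
      fix b :: real
      have "(\<integral>\<^sup>+a. F a b * ?d b \<partial>lborel) = (\<integral>\<^sup>+a. F a b \<partial>lborel) * ?d b"
        by (rule nn_integral_multc) measurable
      then show "ennreal K * ?d b * (\<integral>\<^sup>+a. F a b \<partial>lborel) = ennreal K * (\<integral>\<^sup>+a. F a b * ?d b \<partial>lborel)"
        by (simp add: ac_simps)
    qed
    also have "\<dots> = ennreal K * (\<integral>\<^sup>+b. (\<integral>\<^sup>+a. F a b * ?d b \<partial>lborel) \<partial>lborel)"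
      by (rule nn_integral_cmult) measurable
    finally show "(\<integral>\<^sup>+x. indicator R x * F (sample_mean x) (sample_sd x) \<partial>lborel) =
      ennreal K * (\<integral>\<^sup>+b. (\<integral>\<^sup>+a. F a b * ?d b \<partial>lborel) \<partial>lborel)" .
  qed
qed

section \<open>The standard normal sample\<close>

definition std_normal_sample :: "(real^'n::finite) measure" where
  "std_normal_sample = density lborel (\<lambda>x. ennreal (\<Prod>i\<in>UNIV. std_normal_density (x $ i)))"

lemma sets_std_normal_sample [measurable_cong, simp]: "sets std_normal_sample = sets borel"
  and space_std_normal_sample [simp]: "space std_normal_sample = UNIV"
  by (simp_all add: std_normal_sample_def)

lemma prob_space_std_normal_sample: "prob_space (std_normal_sample :: (real^'n::finite) measure)"
proof (rule prob_spaceI)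
  have "(\<integral>\<^sup>+t. ennreal (std_normal_density t) \<partial>lborel) = ennreal (\<integral>t. std_normal_density t \<partial>lborel)"
    by (rule nn_integral_eq_integral) (auto intro: integrable_normal_density)
  then have *: "(\<integral>\<^sup>+t. ennreal (std_normal_density t) \<partial>lborel) = 1"
    by (simp add: integral_normal_density)
  have "emeasure (std_normal_sample :: (real^'n) measure) UNIV =
      (\<integral>\<^sup>+x. (\<Prod>i\<in>UNIV. ennreal (std_normal_density (x $ i))) \<partial>(lborel :: (real^'n) measure))"
    unfolding std_normal_sample_def
    by (subst emeasure_density) (auto simp: prod_ennreal)
  also have "\<dots> = 1" by (subst nn_integral_lborel_vec_prod) (auto simp: *)
  finally show "emeasure (std_normal_sample :: (real^'n) measure) (space std_normal_sample) = 1" by simp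
qed

lemma prod_std_normal_density:
  "(\<Prod>i\<in>UNIV. std_normal_density (x $ i)) = (1 / sqrt (2 * pi)) ^ CARD('n) * exp (- (norm x)\<^sup>2 / 2)"
  for x :: "real^'n::finite"
proof -
  have "(\<Prod>i\<in>UNIV. std_normal_density (x $ i)) =
      (1 / sqrt (2 * pi)) ^ CARD('n) * (\<Prod>i\<in>UNIV. exp (- (x $ i)\<^sup>2 / 2))"
    unfolding std_normal_density_def by (subst prod.distrib) simp
  also have "(\<Prod>i\<in>UNIV. exp (- (x $ i)\<^sup>2 / 2)) = exp (- (norm x)\<^sup>2 / 2)"
    by (simp add: exp_sum[symmetric] sum_negf sum_divide_distrib[symmetric]
        norm_vec_mean_sd sum_squares_mean_sd)
  finally show ?thesis .
qed

lemma prod_std_normal_density_mean_sd: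
  "(\<Prod>i\<in>UNIV. std_normal_density (x $ i)) = (1 / sqrt (2 * pi)) ^ CARD('n) *
     exp (- real CARD('n) * ((sample_mean x)\<^sup>2 + (sample_sd x)\<^sup>2) / 2)"
  for x :: "real^'n::finite"
  unfolding prod_std_normal_density norm_vec_mean_sd by simp

text \<open>
  The standard normal density is a function of mean and standard deviation alone.  So by the
  disintegration \<open>P(R \<inter> {(mean, sd) \<in> B}) = K\<^sub>R J(B)\<close>, and this product form is independence
  after normalization with \<open>R\<close> or \<open>B\<close> equal to the whole space.
\<close>

lemma std_normal_sample_invariant_factor:
  fixes R :: "(real^'n::finite) set"
  assumes n: "2 \<le> CARD('n)" and R: "invariant_region R"
    and B: "B \<in> sets (borel \<Otimes>\<^sub>M borel)"
  shows "measure std_normal_sample (R \<inter> {x. (sample_mean x, sample_sd x) \<in> B}) =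
     measure std_normal_sample R *
     measure (std_normal_sample :: (real^'n) measure) {x. (sample_mean x, sample_sd x) \<in> B}"
proof -
  let ?P = "std_normal_sample :: (real^'n) measure"
  interpret P: prob_space ?P by (rule prob_space_std_normal_sample)
  define w where "w = (\<lambda>a b. ennreal ((1 / sqrt (2 * pi)) ^ CARD('n) *
     exp (- real CARD('n) * (a\<^sup>2 + b\<^sup>2) / 2)))"
  have w [measurable]: "case_prod w \<in> borel_measurable (borel \<Otimes>\<^sub>M borel)"
    unfolding w_def by measurable
  define J where "J B = (\<integral>\<^sup>+b. (\<integral>\<^sup>+a. (w a b * indicator B (a, b)) *
      (ennreal (b ^ (CARD('n) - 2)) * indicator {0<..} b) \<partial>lborel) \<partial>lborel)" for B
  have key: "\<exists>K\<ge>0. \<forall>B\<in>sets (borel \<Otimes>\<^sub>M borel).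
      emeasure ?P (R \<inter> {x. (sample_mean x, sample_sd x) \<in> B}) = ennreal K * J B"
    if R: "invariant_region R" for R :: "(real^'n) set"
  proof -
    have [measurable]: "R \<in> sets borel" using R by (rule invariant_region_borel)
    obtain K where "0 \<le> K" and K: "\<And>F. case_prod F \<in> borel_measurable (borel \<Otimes>\<^sub>M borel) \<Longrightarrow>
      (\<integral>\<^sup>+x. indicator R x * F (sample_mean x) (sample_sd x) \<partial>lborel) =
      ennreal K * (\<integral>\<^sup>+b. (\<integral>\<^sup>+a. F a b * (ennreal (b ^ (CARD('n) - 2)) * indicator {0<..} b) \<partial>lborel) \<partial>lborel)"
      using invariant_region_disintegration[OF n R] by blast
    have "emeasure ?P (R \<inter> {x. (sample_mean x, sample_sd x) \<in> B}) = ennreal K * J B"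
      if [measurable]: "B \<in> sets (borel \<Otimes>\<^sub>M borel)" for B
    proof -
      have "{x \<in> space borel. (sample_mean x, sample_sd (x :: real^'n)) \<in> B} \<in> sets borel"
        by measurable
      then have [measurable]: "{x. (sample_mean x, sample_sd (x :: real^'n)) \<in> B} \<in> sets borel"
        by simp
      have "emeasure ?P (R \<inter> {x. (sample_mean x, sample_sd x) \<in> B}) =
         (\<integral>\<^sup>+x. indicator R x * (w (sample_mean x) (sample_sd x) *
            indicator B (sample_mean x, sample_sd x)) \<partial>lborel)"
        unfolding std_normal_sample_def
        by (subst emeasure_density)
           (auto simp: prod_std_normal_density_mean_sd w_def indicator_def intro!: nn_integral_cong)
      also have "\<dots> = ennreal K * J B"
        unfolding J_def by (rule K) measurable
      finally show ?thesis .
    qed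
    then show ?thesis using \<open>0 \<le> K\<close> by blast
  qed
  obtain K where K: "0 \<le> K" "\<And>B. B \<in> sets (borel \<Otimes>\<^sub>M borel) \<Longrightarrow>
      emeasure ?P (R \<inter> {x. (sample_mean x, sample_sd x) \<in> B}) = ennreal K * J B"
    using key[OF R] by blast
  have "invariant_region (UNIV :: (real^'n) set)" by (simp add: invariant_region_def)
  from key[OF this] obtain K1 where K1: "0 \<le> K1" "\<And>B. B \<in> sets (borel \<Otimes>\<^sub>M borel) \<Longrightarrow>
      emeasure ?P {x. (sample_mean x, sample_sd x) \<in> B} = ennreal K1 * J B"
    by auto
  have U: "UNIV \<in> sets (borel \<Otimes>\<^sub>M borel :: (real \<times> real) measure)"
    using sets.top[of "borel \<Otimes>\<^sub>M borel :: (real \<times> real) measure"] by (simp add: space_pair_measure)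
  have one: "1 = ennreal K1 * J UNIV"
    using K1(2)[OF U] P.emeasure_space_1 by simp
  have "emeasure ?P (R \<inter> {x. (sample_mean x, sample_sd x) \<in> B}) = (ennreal K1 * J UNIV) * (ennreal K * J B)"
    using K(2)[OF B] by (simp add: one[symmetric])
  also have "\<dots> = (ennreal K * J UNIV) * (ennreal K1 * J B)" by (simp add: ac_simps)
  also have "\<dots> = emeasure ?P R * emeasure ?P {x. (sample_mean x, sample_sd x) \<in> B}"
    using K(2)[OF U] K1(2)[OF B] by simp
  finally have "ennreal (measure ?P (R \<inter> {x. (sample_mean x, sample_sd x) \<in> B})) =
      ennreal (measure ?P R * measure ?P {x. (sample_mean x, sample_sd x) \<in> B})"
    by (simp add: P.emeasure_eq_measure ennreal_mult)
  then show ?thesis by simp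
qed

definition affine_invariant :: "(real^'n \<Rightarrow> 'a) \<Rightarrow> bool" where
  "affine_invariant \<psi> \<longleftrightarrow> (\<forall>a b x. 0 < b \<longrightarrow> \<psi> (\<chi> i. a + b * x $ i) = \<psi> x)"

lemma invariant_region_vimage:
  assumes "affine_invariant \<psi>" "\<psi> \<in> borel_measurable borel" "A \<in> sets borel"
  shows "invariant_region {x. \<psi> x \<in> A}"
  using assms measurable_sets[OF assms(2,3)] unfolding invariant_region_def affine_invariant_def
  by (auto simp: vimage_def)

lemma std_normal_sample_invariant_independent:
  fixes \<psi> :: "real^'n::finite \<Rightarrow> real" and q :: "real \<Rightarrow> real \<Rightarrow> real"
  assumes n: "2 \<le> CARD('n)" and inv: "affine_invariant \<psi>"
    and \<psi>: "integrable std_normal_sample \<psi>"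
    and q [measurable]: "case_prod q \<in> borel_measurable (borel \<Otimes>\<^sub>M borel)"
    and Q: "integrable std_normal_sample (\<lambda>x::real^'n. q (sample_mean x) (sample_sd x))"
  shows "integral\<^sup>L std_normal_sample (\<lambda>x. \<psi> x * q (sample_mean x) (sample_sd x)) =
      integral\<^sup>L std_normal_sample \<psi> *
      integral\<^sup>L std_normal_sample (\<lambda>x::real^'n. q (sample_mean x) (sample_sd x))"
    and "integrable std_normal_sample (\<lambda>x. \<psi> x * q (sample_mean x) (sample_sd x))"
proof -
  let ?P = "std_normal_sample :: (real^'n) measure"
  interpret P: prob_space ?P by (rule prob_space_std_normal_sample)
  let ?Q = "\<lambda>x::real^'n. q (sample_mean x) (sample_sd x)"
  have m\<psi>: "\<psi> \<in> borel_measurable borel"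
    using borel_measurable_integrable[OF \<psi>] by simp
  have [measurable]: "?Q \<in> borel_measurable borel" by measurable
  have "P.indep_set {\<psi> -` A \<inter> space ?P |A. A \<in> sets borel} {?Q -` A \<inter> space ?P |A. A \<in> sets borel}"
  proof (safe intro!: P.indep_setI)
    fix A :: "real set" assume A: "A \<in> sets borel"
    show "\<psi> -` A \<inter> space ?P \<in> sets ?P" using measurable_sets[OF m\<psi> A] by simp
    show "?Q -` A \<inter> space ?P \<in> sets ?P" using measurable_sets[of ?Q borel borel A] A by simp
  next
    fix A B :: "real set" assume A: "A \<in> sets borel" and B: "B \<in> sets borel"
    have "case_prod q -` B \<inter> space (borel \<Otimes>\<^sub>M borel) \<in> sets (borel \<Otimes>\<^sub>M borel)"
      by (rule measurable_sets[OF q B])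
    then have B': "case_prod q -` B \<in> sets (borel \<Otimes>\<^sub>M borel)"
      by (simp add: space_pair_measure)
    show "P.prob ((\<psi> -` A \<inter> space ?P) \<inter> (?Q -` B \<inter> space ?P)) =
        P.prob (\<psi> -` A \<inter> space ?P) * P.prob (?Q -` B \<inter> space ?P)"
      using std_normal_sample_invariant_factor[OF n invariant_region_vimage[OF inv m\<psi> A] B']
      by (simp add: vimage_def Int_def)
  qed
  then have indep: "P.indep_var borel \<psi> borel ?Q"
    unfolding P.indep_var_eq
  proof (intro conjI P.indep_set_sigma_sets)
    show "Int_stable {X -` A \<inter> space ?P |A. A \<in> sets borel}" for X :: "real^'n \<Rightarrow> real"
    proof (safe intro!: Int_stableI)
      fix A B :: "real set" assume "A \<in> sets borel" "B \<in> sets borel"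
      then show "\<exists>C. X -` A \<inter> space ?P \<inter> (X -` B \<inter> space ?P) = X -` C \<inter> space ?P \<and> C \<in> sets borel"
        by (intro exI[of _ "A \<inter> B"]) auto
    qed
    then show "Int_stable {?Q -` A \<inter> space ?P |A. A \<in> sets borel}" .
  qed (use m\<psi> in \<open>auto simp: measurable_cong_sets[OF sets_std_normal_sample refl]\<close>)
  show "integral\<^sup>L ?P (\<lambda>x. \<psi> x * ?Q x) = integral\<^sup>L ?P \<psi> * integral\<^sup>L ?P ?Q"
    by (rule P.indep_var_lebesgue_integral[OF indep \<psi> Q])
  show "integrable ?P (\<lambda>x. \<psi> x * ?Q x)"
    by (rule P.indep_var_integrable[OF indep \<psi> Q])
qed

lemma power_le_fact_exp:
  fixes t :: real
  assumes "0 \<le> t"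
  shows "t ^ m \<le> fact m * exp t"
proof -
  have "(\<Sum>k\<in>{m}. t ^ k /\<^sub>R fact k) \<le> exp t"
    unfolding exp_def by (rule sum_le_suminf) (use assms summable_exp[of t] in \<open>auto simp: field_simps\<close>)
  then show ?thesis by (simp add: field_simps)
qed

text \<open>
  Polynomial growth costs only a part of the Gaussian decay: \<open>t - t\<^sup>2/2 \<le> 1 - t\<^sup>2/4\<close> bounds
  \<open>t\<^sup>m exp (- t\<^sup>2/2)\<close> by a multiple of a Gaussian with doubled variance, which is a product of
  one-dimensional integrable functions.
\<close>

lemma integrable_std_normal_sample_norm_power:
  "integrable std_normal_sample (\<lambda>x::real^'n::finite. norm x ^ m)"
proof (rule integrableI_nonneg)
  let ?c = "1 / sqrt (2 * pi)"
  let ?C = "fact m * exp 1 * ?c ^ CARD('n)"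
  have bound: "?c ^ CARD('n) * exp (- (norm x)\<^sup>2 / 2) * norm x ^ m \<le> ?C * (\<Prod>i\<in>UNIV. exp (- (x $ i)\<^sup>2 / 4))"
    for x :: "real^'n"
  proof -
    have "0 \<le> (norm x / 2 - 1)\<^sup>2" by simp
    then have "norm x - (norm x)\<^sup>2 / 2 \<le> 1 - (norm x)\<^sup>2 / 4"
      by (simp add: power2_eq_square field_simps)
    then have "exp (norm x) * exp (- (norm x)\<^sup>2 / 2) \<le> exp 1 * exp (- (norm x)\<^sup>2 / 4)"
      unfolding exp_add[symmetric] by simp
    moreover have "norm x ^ m * exp (- (norm x)\<^sup>2 / 2) \<le> fact m * exp (norm x) * exp (- (norm x)\<^sup>2 / 2)"
      by (intro mult_right_mono power_le_fact_exp) auto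
    ultimately have "norm x ^ m * exp (- (norm x)\<^sup>2 / 2) \<le> fact m * (exp 1 * exp (- (norm x)\<^sup>2 / 4))"
      by (smt (verit, best) fact_ge_zero mult.assoc mult_left_mono)
    moreover have "exp (- (norm x)\<^sup>2 / 4) = (\<Prod>i\<in>UNIV. exp (- (x $ i)\<^sup>2 / 4))"
      by (simp add: exp_sum[symmetric] sum_negf sum_divide_distrib[symmetric]
          norm_vec_mean_sd sum_squares_mean_sd)
    ultimately have "?c ^ CARD('n) * (norm x ^ m * exp (- (norm x)\<^sup>2 / 2)) \<le>
        ?c ^ CARD('n) * (fact m * (exp 1 * (\<Prod>i\<in>UNIV. exp (- (x $ i)\<^sup>2 / 4))))"
      by (intro mult_left_mono) auto
    then show ?thesis by (simp add: ac_simps)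
  qed
  have fin: "(\<integral>\<^sup>+t. ennreal (exp (- t\<^sup>2 / 4)) \<partial>lborel) < \<infinity>"
  proof -
    have "integrable lborel (\<lambda>t. sqrt (4 * pi) * normal_density 0 (sqrt 2) t)"
      by (intro integrable_mult_right integrable_normal_density) simp
    also have "(\<lambda>t. sqrt (4 * pi) * normal_density 0 (sqrt 2) t) = (\<lambda>t. exp (- t\<^sup>2 / 4))"
      by (auto simp: normal_density_def fun_eq_iff)
    finally show ?thesis unfolding integrable_iff_bounded by simp
  qed
  have "(\<integral>\<^sup>+x. ennreal (norm x ^ m) \<partial>(std_normal_sample :: (real^'n) measure)) =
     (\<integral>\<^sup>+x. ennreal (?c ^ CARD('n) * exp (- (norm x)\<^sup>2 / 2) * norm x ^ m) \<partial>(lborel :: (real^'n) measure))"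
    unfolding std_normal_sample_def
    by (subst nn_integral_density) (auto simp: prod_std_normal_density ennreal_mult)
  also have "\<dots> \<le> (\<integral>\<^sup>+x. ennreal ?C * (\<Prod>i\<in>UNIV. ennreal (exp (- (x $ i)\<^sup>2 / 4))) \<partial>(lborel :: (real^'n) measure))"
    using bound by (intro nn_integral_mono) (auto simp: prod_ennreal ennreal_mult[symmetric] prod_nonneg intro!: ennreal_leI)
  also have "\<dots> = ennreal ?C * (\<integral>\<^sup>+t. ennreal (exp (- t\<^sup>2 / 4)) \<partial>lborel) ^ CARD('n)"
    by (subst nn_integral_cmult, measurable, subst nn_integral_lborel_vec_prod) auto
  also have "\<dots> < \<infinity>" using fin by (simp add: ennreal_mult_less_top power_less_top_ennreal)
  finally show "(\<integral>\<^sup>+x. ennreal (norm x ^ m) \<partial>(std_normal_sample :: (real^'n) measure)) < \<infinity>" .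
qed auto

lemma abs_sample_mean_le_norm: "\<bar>sample_mean x\<bar> \<le> norm x"
  and sample_sd_le_norm: "sample_sd x \<le> norm x" for x :: "real^'n::finite"
proof -
  have sum: "1 * ((sample_mean x)\<^sup>2 + (sample_sd x)\<^sup>2) \<le> (norm x)\<^sup>2"
    unfolding norm_vec_mean_sd by (intro mult_right_mono) (auto simp: Suc_le_eq)
  have "(sample_mean x)\<^sup>2 \<le> 1 * ((sample_mean x)\<^sup>2 + (sample_sd x)\<^sup>2)" by simp
  also note sum
  finally have "(sample_mean x)\<^sup>2 \<le> (norm x)\<^sup>2" .
  moreover have "(sample_sd x)\<^sup>2 \<le> 1 * ((sample_mean x)\<^sup>2 + (sample_sd x)\<^sup>2)" by simp
  from this sum have "(sample_sd x)\<^sup>2 \<le> (norm x)\<^sup>2" by (rule order_trans)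
  ultimately show "\<bar>sample_mean x\<bar> \<le> norm x" "sample_sd x \<le> norm x"
    by (auto intro: power2_le_imp_le abs_le_square_iff[THEN iffD2] simp: power2_le_iff_abs_le)
qed

lemma integrable_mean_sd_monomial:
  "integrable std_normal_sample (\<lambda>x::real^'n::finite. sample_mean x ^ j * sample_sd x ^ k)"
proof (rule Bochner_Integration.integrable_bound[OF integrable_std_normal_sample_norm_power[of "j + k"]])
  show "AE x::real^'n in std_normal_sample.
      norm (sample_mean x ^ j * sample_sd x ^ k) \<le> norm (norm x ^ (j + k))"
    by (auto simp: abs_mult power_abs power_add sample_sd_nonneg intro!: AE_I2 mult_mono power_mono
        abs_sample_mean_le_norm sample_sd_le_norm)
qed measurable

text \<open>
  The reflection \<open>x \<mapsto> -x\<close> preserves the normal law and the standard deviation, and negates the mean.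
\<close>

lemma integral_mean_sd_odd:
  assumes "odd j"
  shows "integral\<^sup>L std_normal_sample (\<lambda>x::real^'n::finite. sample_mean x ^ j * sample_sd x ^ k) = 0"
proof -
  have neg: "- x = (\<chi> i. 0 + (- 1) * x $ i)" for x :: "real^'n" by (simp add: vec_eq_iff)
  have mn: "sample_mean (- x) = - sample_mean x" and sn: "sample_sd (- x) = sample_sd x" for x :: "real^'n"
    unfolding neg sample_mean_affine sample_sd_affine by simp_all
  let ?p = "\<lambda>x::real^'n. \<Prod>i\<in>UNIV. std_normal_density (x $ i)"
  let ?h = "\<lambda>x::real^'n. ?p x * (sample_mean x ^ j * sample_sd x ^ k)"
  have d: "distr lborel borel uminus = (lborel :: (real^'n) measure)"
    by (subst lborel_affine[of "-1" 0]) (auto simp: density_1 one_ennreal_def[symmetric])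
  have pn: "?p (- x) = ?p x" for x by (simp only: prod_std_normal_density norm_minus_cancel)
  have "integral\<^sup>L lborel ?h = integral\<^sup>L (distr lborel borel uminus) ?h" unfolding d ..
  also have "\<dots> = integral\<^sup>L lborel (\<lambda>x. ?h (- x))"
    by (subst integral_distr) auto
  also have "\<dots> = - integral\<^sup>L lborel ?h"
    using assms by (simp add: pn mn sn del: vector_uminus_component)
  finally have "integral\<^sup>L lborel ?h = 0" by simp
  then show ?thesis
    unfolding std_normal_sample_def
    by (subst integral_density) (auto simp: prod_nonneg)
qed

section \<open>Differentiating the power function at the null hypothesis\<close>

text \<open>
  A variant of the dominating function in which \<open>x = a + b z\<close> ranges over the open interval
  \<open>\<bar>z\<bar> < \<surd>n\<close>.  Its superlevel sets are unions of open cones, so it is Borel measurable in \<open>(a, b)\<close>,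
  whereas unions of closed cones need not be Borel sets.  Nothing is lost by
  \<open>abs_deviation_less\<close>: standardized observations never attain \<open>\<surd>n\<close> in absolute value.
\<close>

definition open_dom_fun :: "(real \<Rightarrow> real \<Rightarrow> real) \<Rightarrow> nat \<Rightarrow> real \<Rightarrow> real \<Rightarrow> real \<Rightarrow> ennreal" where
  "open_dom_fun f n \<epsilon> a b =
     (SUP (x, \<theta>) \<in> {x. \<bar>x - a\<bar> < b * sqrt (real n)} \<times> {0..\<epsilon>}.
        ennreal (\<bar>theta_deriv (f x) \<theta>\<bar> / f x 0))"

lemma open_dom_fun_le_dom_fun:
  assumes "0 < b"
  shows "open_dom_fun f n \<epsilon> a b \<le> dom_fun f n \<epsilon> a b"
  unfolding open_dom_fun_def
proof (rule SUP_least, clarify)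
  fix x \<theta> :: real
  assume x: "\<bar>x - a\<bar> < b * sqrt (real n)" and \<theta>: "\<theta> \<in> {0..\<epsilon>}"
  have "((x - a) / b, \<theta>) \<in> {z. \<bar>z\<bar> \<le> sqrt (real n)} \<times> {0..\<epsilon>}"
    using x \<theta> assms by (auto simp: field_simps)
  from SUP_upper[OF this, of "\<lambda>(z, \<theta>). ennreal (\<bar>theta_deriv (f (a + b * z)) \<theta>\<bar> / f (a + b * z) 0)"]
  show "ennreal (\<bar>theta_deriv (f x) \<theta>\<bar> / f x 0) \<le> dom_fun f n \<epsilon> a b"
    using assms by (simp add: dom_fun_def)
qed

lemma borel_measurable_open_dom_fun [measurable]:
  "(\<lambda>(a, b). open_dom_fun f n \<epsilon> a b) \<in> borel_measurable (borel \<Otimes>\<^sub>M borel)"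
  unfolding borel_prod
proof (rule borel_measurableI_greater)
  fix y
  let ?S = "{(x, \<theta>). \<theta> \<in> {0..\<epsilon>} \<and> y < ennreal (\<bar>theta_deriv (f x) \<theta>\<bar> / f x 0)}"
  have "{p \<in> space borel. y < (\<lambda>(a, b). open_dom_fun f n \<epsilon> a b) p} =
      (\<Union>(x, \<theta>)\<in>?S. {p. \<bar>x - fst p\<bar> < snd p * sqrt (real n)})"
    by (fastforce simp: open_dom_fun_def less_SUP_iff)
  moreover have "open \<dots>"
    by (intro open_UN ballI) (auto split: prod.splits intro!: open_Collect_less continuous_intros)
  ultimately show "{p \<in> space borel. y < (\<lambda>(a, b). open_dom_fun f n \<epsilon> a b) p} \<in> sets borel"
    by simp
qed

text \<open>
  Equality would mean that all other deviations vanish; as deviations sum to zero, so would this one.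
\<close>

lemma abs_deviation_less:
  fixes x :: "real^'n::finite"
  assumes "0 < sample_sd x"
  shows "\<bar>x $ i - sample_mean x\<bar> < sample_sd x * sqrt (real CARD('n))"
proof -
  let ?d = "\<lambda>j. x $ j - sample_mean x"
  have split: "real CARD('n) * (sample_sd x)\<^sup>2 = (?d i)\<^sup>2 + (\<Sum>j\<in>UNIV - {i}. (?d j)\<^sup>2)"
    unfolding sum_deviations_square[symmetric] by (rule sum.remove) auto
  have "(\<Sum>j\<in>UNIV - {i}. (?d j)\<^sup>2) > 0"
  proof (rule ccontr)
    assume "\<not> ?thesis"
    moreover have "0 \<le> (\<Sum>j\<in>UNIV - {i}. (?d j)\<^sup>2)" by (intro sum_nonneg) auto
    ultimately have z: "(\<Sum>j\<in>UNIV - {i}. (?d j)\<^sup>2) = 0" by linarith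
    then have "\<forall>j\<in>UNIV - {i}. (?d j)\<^sup>2 = 0"
      by (subst (asm) sum_nonneg_eq_0_iff) auto
    then have "(\<Sum>j\<in>UNIV - {i}. ?d j) = 0" by simp
    moreover have "0 = ?d i + (\<Sum>j\<in>UNIV - {i}. ?d j)"
      unfolding sum_deviations[of x, symmetric] by (rule sum.remove) auto
    ultimately have "real CARD('n) * (sample_sd x)\<^sup>2 = 0"
      unfolding split z by simp
    then show False using assms by simp
  qed
  then have "(?d i)\<^sup>2 < real CARD('n) * (sample_sd x)\<^sup>2" unfolding split by linarith
  then have "sqrt ((?d i)\<^sup>2) < sqrt (real CARD('n) * (sample_sd x)\<^sup>2)"
    by (rule real_sqrt_less_mono)
  then show ?thesis using assms by (simp add: real_sqrt_mult mult.commute)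
qed

text \<open>
  Convexity of \<open>t \<mapsto> (1 + t)\<^sup>n\<close> on the segment from \<open>0\<close> to \<open>y\<close>.
\<close>

lemma power_chord_bound:
  fixes y l :: real
  assumes "0 \<le> y" "0 \<le> l" "l \<le> 1"
  shows "(1 + l * y) ^ n \<le> 1 + l * ((1 + y) ^ n - 1)"
proof (induction n)
  case (Suc n)
  let ?A = "(1 + y) ^ n"
  have A: "1 \<le> ?A" using assms by (simp add: one_le_power)
  have "(1 + l * y) ^ Suc n \<le> (1 + l * y) * (1 + l * (?A - 1))"
    using Suc assms by (simp add: mult_left_mono)
  also have "\<dots> = 1 + l * ((1 + y) ^ Suc n - 1) - l * (1 - l) * (y * (?A - 1))"
    by (simp add: algebra_simps)
  also have "\<dots> \<le> 1 + l * ((1 + y) ^ Suc n - 1)"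
    using assms A by simp
  finally show ?case .
qed simp

lemma abs_prod_minus_one_le:
  fixes r :: "'i \<Rightarrow> real"
  assumes "finite I" "\<And>i. i \<in> I \<Longrightarrow> \<bar>r i - 1\<bar> \<le> d"
  shows "\<bar>(\<Prod>i\<in>I. r i) - 1\<bar> \<le> (1 + d) ^ card I - 1"
  using assms
proof (induction I)
  case (insert i I)
  let ?p = "\<Prod>i\<in>I. r i"
  have p: "\<bar>?p - 1\<bar> \<le> (1 + d) ^ card I - 1" and i: "\<bar>r i - 1\<bar> \<le> d"
    using insert by auto
  have "\<bar>r i * ?p - 1\<bar> = \<bar>r i * (?p - 1) + (r i - 1)\<bar>" by (simp add: algebra_simps)
  also have "\<dots> \<le> \<bar>r i\<bar> * \<bar>?p - 1\<bar> + \<bar>r i - 1\<bar>"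
    by (metis abs_mult abs_triangle_ineq)
  also have "\<dots> \<le> (1 + d) * ((1 + d) ^ card I - 1) + d"
    using p i by (intro add_mono mult_mono) auto
  also have "\<dots> = (1 + d) ^ Suc (card I) - 1" by (simp add: algebra_simps)
  finally show ?case using insert by simp
qed simp

lemma ennreal_affine:
  "0 \<le> p \<Longrightarrow> 0 \<le> q \<Longrightarrow> 0 \<le> r \<Longrightarrow> ennreal (p * (1 + q * r)) = ennreal p * (1 + ennreal q * ennreal r)"
  by (simp add: ennreal_mult ennreal_plus)

context
  fixes f :: "real \<Rightarrow> real \<Rightarrow> real"
  assumes smooth: "smooth_density_family f"
begin

lemma density_pos: "0 \<le> \<theta> \<Longrightarrow> 0 < f x \<theta>"
  using smooth by (simp add: smooth_density_family_def)

lemma density_measurable: "0 \<le> \<theta> \<Longrightarrow> (\<lambda>x. f x \<theta>) \<in> borel_measurable borel"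
  using smooth by (simp add: smooth_density_family_def)

lemma log_density_has_theta_deriv:
  assumes "0 \<le> \<theta>"
  shows "((\<lambda>\<theta>. ln (f x \<theta>)) has_real_derivative theta_deriv (\<lambda>\<theta>. ln (f x \<theta>)) \<theta>) (at \<theta> within {0..})"
proof -
  have "(\<lambda>\<theta>. ln (f x \<theta>)) differentiable (at \<theta> within {0..})"
    using smooth assms by (auto simp: smooth_density_family_def differentiable_on_def)
  then show ?thesis
    unfolding theta_deriv_def has_real_derivative_iff_has_vector_derivative
    by (simp add: vector_derivative_works)
qed

lemma density_has_theta_deriv:
  assumes "0 \<le> \<theta>"
  shows "(f x has_real_derivative theta_deriv (f x) \<theta>) (at \<theta> within {0..})"
proof -
  have "((\<lambda>\<theta>. exp (ln (f x \<theta>))) has_real_derivative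
      exp (ln (f x \<theta>)) * theta_deriv (\<lambda>\<theta>. ln (f x \<theta>)) \<theta>) (at \<theta> within {0..})"
    by (rule DERIV_chain'[OF log_density_has_theta_deriv[OF assms]]) (rule DERIV_exp)
  then have "(f x has_real_derivative
      exp (ln (f x \<theta>)) * theta_deriv (\<lambda>\<theta>. ln (f x \<theta>)) \<theta>) (at \<theta> within {0..})"
    by (rule has_field_derivative_transform_within[OF _ zero_less_one]) (use assms density_pos in auto)
  then have "f x differentiable (at \<theta> within {0..})"
    by (auto simp: has_field_derivative_def differentiable_def)
  then show ?thesis
    unfolding theta_deriv_def has_real_derivative_iff_has_vector_derivative
    by (simp add: vector_derivative_works)
qed

lemma density_increment_bound:
  assumes "0 \<le> \<theta>" "\<theta> \<le> \<epsilon>" and B: "\<And>\<eta>. 0 \<le> \<eta> \<Longrightarrow> \<eta> \<le> \<epsilon> \<Longrightarrow> \<bar>theta_deriv (f x) \<eta>\<bar> \<le> B"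
  shows "\<bar>f x \<theta> - f x 0\<bar> \<le> B * \<theta>"
proof -
  have "norm (f x \<theta> - f x 0) \<le> B * norm (\<theta> - 0)"
  proof (rule field_differentiable_bound[where S = "{0..\<epsilon>}" and f' = "theta_deriv (f x)"])
    show "(f x has_real_derivative theta_deriv (f x) \<eta>) (at \<eta> within {0..\<epsilon>})" if "\<eta> \<in> {0..\<epsilon>}" for \<eta>
      by (rule DERIV_subset[OF density_has_theta_deriv]) (use that in auto)
  qed (use assms in auto)
  then show ?thesis using assms by simp
qed

lemma joint_density_pos: "0 \<le> \<theta> \<Longrightarrow> 0 < joint_density f \<theta> x"
  by (simp add: joint_density_def prod_pos density_pos)

lemma joint_density_quotient_tendsto:
  fixes x :: "real^'n::finite"
  shows "((\<lambda>\<theta>. (joint_density f \<theta> x / joint_density f 0 x - 1) / \<theta>) \<longlongrightarrow>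
    (\<Sum>i\<in>UNIV. score0 f (x $ i))) (at_right 0)"
proof -
  let ?L = "\<lambda>\<theta>. \<Sum>i\<in>UNIV. ln (f (x $ i) \<theta>)"
  have jd: "joint_density f \<theta> x = exp (?L \<theta>)" if "0 \<le> \<theta>" for \<theta>
    using density_pos[OF that] by (simp add: exp_sum joint_density_def)
  have "((\<lambda>\<theta>. exp (?L \<theta> - ?L 0)) has_real_derivative
      exp (?L 0 - ?L 0) * ((\<Sum>i\<in>UNIV. score0 f (x $ i)) - 0)) (at 0 within {0..})"
    unfolding score0_def
    by (rule DERIV_chain'[OF _ DERIV_exp]) (intro DERIV_diff DERIV_sum DERIV_const log_density_has_theta_deriv order_refl)
  then have "((\<lambda>\<theta>. (exp (?L \<theta> - ?L 0) - 1) / \<theta>) \<longlongrightarrow> (\<Sum>i\<in>UNIV. score0 f (x $ i))) (at 0 within {0..})"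
    by (simp add: has_field_derivative_iff)
  then have "((\<lambda>\<theta>. (exp (?L \<theta> - ?L 0) - 1) / \<theta>) \<longlongrightarrow> (\<Sum>i\<in>UNIV. score0 f (x $ i))) (at_right 0)"
    by (rule tendsto_within_subset) auto
  then show ?thesis
  proof (rule Lim_transform_eventually)
    show "\<forall>\<^sub>F \<theta> in at_right 0. (exp (?L \<theta> - ?L 0) - 1) / \<theta> = (joint_density f \<theta> x / joint_density f 0 x - 1) / \<theta>"
      using eventually_at_right_less[of "0::real"] by eventually_elim (simp add: jd exp_diff)
  qed
qed

text \<open>
  The bound does not depend on \<open>\<theta>\<close> and grows like \<open>\<Gamma>\<^sup>n\<close>.  This is why the integrability hypothesis
  concerns the \<open>n\<close>-th power of the dominating function.
\<close>

lemma joint_density_quotient_bound: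
  fixes x :: "real^'n::finite"
  assumes "0 < \<theta>" "\<theta> \<le> \<epsilon>" "0 \<le> \<Gamma>"
    and B: "\<And>i \<eta>. 0 \<le> \<eta> \<Longrightarrow> \<eta> \<le> \<epsilon> \<Longrightarrow> \<bar>theta_deriv (f (x $ i)) \<eta>\<bar> / f (x $ i) 0 \<le> \<Gamma>"
  shows "\<bar>(joint_density f \<theta> x / joint_density f 0 x - 1) / \<theta>\<bar> \<le> (1 + \<epsilon> * \<Gamma>) ^ CARD('n) / \<epsilon>"
proof -
  let ?r = "\<lambda>i. f (x $ i) \<theta> / f (x $ i) 0"
  have r: "\<bar>?r i - 1\<bar> \<le> (\<theta> / \<epsilon>) * (\<epsilon> * \<Gamma>)" for i
  proof -
    have "\<bar>f (x $ i) \<theta> - f (x $ i) 0\<bar> \<le> (\<Gamma> * f (x $ i) 0) * \<theta>"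
      by (rule density_increment_bound[where \<epsilon> = \<epsilon>])
         (use assms density_pos[of 0] in \<open>auto simp: field_simps\<close>)
    moreover have "?r i - 1 = (f (x $ i) \<theta> - f (x $ i) 0) / f (x $ i) 0"
      using density_pos[of 0 "x $ i"] by (simp add: diff_divide_distrib)
    ultimately show ?thesis
      using density_pos[of 0 "x $ i"] assms by (simp add: abs_divide field_simps)
  qed
  have "\<bar>joint_density f \<theta> x / joint_density f 0 x - 1\<bar> = \<bar>(\<Prod>i\<in>UNIV. ?r i) - 1\<bar>"
    by (simp add: joint_density_def prod_dividef)
  also have "\<dots> \<le> (1 + (\<theta> / \<epsilon>) * (\<epsilon> * \<Gamma>)) ^ CARD('n) - 1"
    by (rule abs_prod_minus_one_le) (use r in auto)
  also have "\<dots> \<le> (\<theta> / \<epsilon>) * ((1 + \<epsilon> * \<Gamma>) ^ CARD('n) - 1)"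
    using power_chord_bound[of "\<epsilon> * \<Gamma>" "\<theta> / \<epsilon>" "CARD('n)"] assms by simp
  also have "\<dots> \<le> (\<theta> / \<epsilon>) * (1 + \<epsilon> * \<Gamma>) ^ CARD('n)"
    using assms by (intro mult_left_mono) auto
  finally have "\<bar>joint_density f \<theta> x / joint_density f 0 x - 1\<bar> / \<theta> \<le>
      ((\<theta> / \<epsilon>) * (1 + \<epsilon> * \<Gamma>) ^ CARD('n)) / \<theta>"
    using assms by (intro divide_right_mono) auto
  then show ?thesis using assms by (simp add: abs_divide)
qed

context
  assumes null: "\<And>x. f x 0 = 1 / sqrt (2 * pi) * exp (- x\<^sup>2 / 2)"
begin

lemma joint_density_null:
  "joint_density f 0 x = (\<Prod>i\<in>UNIV. std_normal_density (x $ i))"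
  by (simp add: joint_density_def null std_normal_density_def)

lemma prob_region_eq_integral:
  fixes R :: "(real^'n::finite) set"
  assumes \<theta>: "0 \<le> \<theta>" and R: "R \<in> sets borel"
  shows "prob_region f \<theta> R =
      (\<integral>x. indicator R x * (joint_density f \<theta> x / joint_density f 0 x) \<partial>std_normal_sample)"
    and "integrable std_normal_sample
      (\<lambda>x. indicator R x * (joint_density f \<theta> x / joint_density f 0 x))"
proof -
  note [measurable] = R density_measurable[OF \<theta>]
    borel_measurable_joint_density[where f = f and \<theta> = \<theta>, OF density_measurable[OF \<theta>]]
    borel_measurable_joint_density[where f = f and \<theta> = 0, OF density_measurable[OF order_refl]]
  let ?g = "\<lambda>x::real^'n. indicator R x * (joint_density f \<theta> x / joint_density f 0 x)"
  have pos: "0 < joint_density f \<theta> x" "0 < joint_density f 0 x" for x :: "real^'n"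
    using joint_density_pos \<theta> by auto
  have law: "(sample_law f 0 1 \<theta> :: (real^'n) measure) = density lborel (joint_density f \<theta>)"
    using smooth \<theta> by (intro sample_law_eq_density) (auto simp: smooth_density_family_def less_imp_le)
  have "(\<integral>\<^sup>+x. ennreal (?g x) \<partial>std_normal_sample) =
      (\<integral>\<^sup>+x. ennreal (joint_density f 0 x) * ennreal (?g x) \<partial>lborel)"
    unfolding std_normal_sample_def joint_density_null[symmetric]
    by (rule nn_integral_density) measurable
  also have "\<dots> = (\<integral>\<^sup>+x. ennreal (joint_density f \<theta> x) * indicator R x \<partial>lborel)"
    using pos by (intro nn_integral_cong)
      (auto simp: indicator_def ennreal_mult[symmetric] less_imp_le less_imp_neq[THEN not_sym] simp del: ennreal_mult)
  also have "\<dots> = emeasure (sample_law f 0 1 \<theta>) R"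
    unfolding law by (rule emeasure_density[symmetric]) auto
  finally have nn: "(\<integral>\<^sup>+x. ennreal (?g x) \<partial>std_normal_sample) = emeasure (sample_law f 0 1 \<theta>) R" .
  have "emeasure (sample_law f 0 1 \<theta> :: (real^'n) measure) R \<le> emeasure (sample_law f 0 1 \<theta> :: (real^'n) measure) UNIV"
    by (rule emeasure_mono) (auto simp: law)
  also have "\<dots> = (\<integral>\<^sup>+x. (\<Prod>i\<in>UNIV. ennreal (f (x $ i) \<theta>)) \<partial>(lborel :: (real^'n) measure))"
    unfolding law
    by (subst emeasure_density) (auto simp: joint_density_def prod_ennreal density_pos \<theta> less_imp_le)
  also have "\<dots> = 1"
    using smooth \<theta> density_measurable[OF \<theta>]
    by (subst nn_integral_lborel_vec_prod) (auto simp: smooth_density_family_def)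
  finally have fin: "emeasure (sample_law f 0 1 \<theta> :: (real^'n) measure) R < \<infinity>"
    by (rule order_le_less_trans) simp
  show "integrable std_normal_sample ?g"
    by (rule integrableI_nonneg) (use fin nn pos in \<open>auto simp: less_imp_le\<close>)
  show "prob_region f \<theta> R = integral\<^sup>L std_normal_sample ?g"
    unfolding prob_region_def measure_def nn[symmetric]
    by (rule integral_eq_nn_integral[symmetric]) (use pos in \<open>auto simp: less_imp_le\<close>)
qed

text \<open>
  The iterated integral of the hypothesis is, up to a constant, an integral over sample space in the
  coordinates \<open>(mean, sd)\<close>.
\<close>

lemma open_dom_fun_integrable:
  assumes n: "2 \<le> CARD('n::finite)"
    and dom: "(\<integral>\<^sup>+b\<in>{0<..}. (\<integral>\<^sup>+a. dom_fun f CARD('n) \<epsilon> a b ^ CARD('n) *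
        ennreal (exp (- real CARD('n) * (a\<^sup>2 + b\<^sup>2) / 2) * b ^ (CARD('n) - 2)) \<partial>lborel) \<partial>lborel) < \<infinity>"
  shows "(\<integral>\<^sup>+x. open_dom_fun f CARD('n) \<epsilon> (sample_mean x) (sample_sd x) ^ CARD('n)
      \<partial>(std_normal_sample :: (real^'n) measure)) < \<infinity>"
proof -
  let ?n = "CARD('n)"
  let ?c = "(1 / sqrt (2 * pi)) ^ ?n"
  let ?e = "\<lambda>a b. exp (- real ?n * (a\<^sup>2 + b\<^sup>2) / 2)"
  let ?F = "\<lambda>a b. open_dom_fun f ?n \<epsilon> a b ^ ?n * ennreal (?c * ?e a b)"
  have "invariant_region (UNIV :: (real^'n) set)" by (simp add: invariant_region_def)
  then obtain K where "0 \<le> K" and K: "\<And>F. case_prod F \<in> borel_measurable (borel \<Otimes>\<^sub>M borel) \<Longrightarrow>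
      (\<integral>\<^sup>+x. indicator (UNIV :: (real^'n) set) x * F (sample_mean x) (sample_sd x) \<partial>lborel) =
      ennreal K * (\<integral>\<^sup>+b. (\<integral>\<^sup>+a. F a b * (ennreal (b ^ (?n - 2)) * indicator {0<..} b) \<partial>lborel) \<partial>lborel)"
    using invariant_region_disintegration[OF n] by blast
  have "(\<integral>\<^sup>+x. open_dom_fun f ?n \<epsilon> (sample_mean x) (sample_sd x) ^ ?n \<partial>(std_normal_sample :: (real^'n) measure)) =
     (\<integral>\<^sup>+x. indicator (UNIV :: (real^'n) set) x * ?F (sample_mean x) (sample_sd x) \<partial>lborel)"
    unfolding std_normal_sample_def
    by (subst nn_integral_density) (auto simp: prod_std_normal_density_mean_sd mult.commute)
  also have "\<dots> = ennreal K * (\<integral>\<^sup>+b. (\<integral>\<^sup>+a. ?F a b * (ennreal (b ^ (?n - 2)) * indicator {0<..} b) \<partial>lborel) \<partial>lborel)"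
    by (rule K) measurable
  also have "(\<integral>\<^sup>+b. (\<integral>\<^sup>+a. ?F a b * (ennreal (b ^ (?n - 2)) * indicator {0<..} b) \<partial>lborel) \<partial>lborel) =
     (\<integral>\<^sup>+b. (\<integral>\<^sup>+a. ennreal ?c * (open_dom_fun f ?n \<epsilon> a b ^ ?n * ennreal (?e a b * b ^ (?n - 2)) * indicator {0<..} b) \<partial>lborel) \<partial>lborel)"
    by (intro nn_integral_cong) (auto simp: indicator_def ennreal_mult ac_simps)
  also have "\<dots> = ennreal ?c * (\<integral>\<^sup>+b. (\<integral>\<^sup>+a. (open_dom_fun f ?n \<epsilon> a b ^ ?n * ennreal (?e a b * b ^ (?n - 2)) * indicator {0<..} b) \<partial>lborel) \<partial>lborel)"
    by (subst nn_integral_cmult, measurable)+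
  finally have eq: "(\<integral>\<^sup>+x. open_dom_fun f ?n \<epsilon> (sample_mean x) (sample_sd x) ^ ?n
      \<partial>(std_normal_sample :: (real^'n) measure)) = ennreal K * \<dots>" .
  have "(\<integral>\<^sup>+b. (\<integral>\<^sup>+a. (open_dom_fun f ?n \<epsilon> a b ^ ?n * ennreal (?e a b * b ^ (?n - 2)) * indicator {0<..} b) \<partial>lborel) \<partial>lborel)
     \<le> (\<integral>\<^sup>+b\<in>{0<..}. (\<integral>\<^sup>+a. dom_fun f CARD('n) \<epsilon> a b ^ CARD('n) *
        ennreal (exp (- real CARD('n) * (a\<^sup>2 + b\<^sup>2) / 2) * b ^ (CARD('n) - 2)) \<partial>lborel) \<partial>lborel)"
  proof (rule nn_integral_mono)
    fix b :: real
    show "(\<integral>\<^sup>+a. (open_dom_fun f ?n \<epsilon> a b ^ ?n * ennreal (?e a b * b ^ (?n - 2)) * indicator {0<..} b) \<partial>lborel)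
      \<le> (\<integral>\<^sup>+a. dom_fun f CARD('n) \<epsilon> a b ^ CARD('n) *
        ennreal (exp (- real CARD('n) * (a\<^sup>2 + b\<^sup>2) / 2) * b ^ (CARD('n) - 2)) \<partial>lborel) * indicator {0<..} b"
    proof (cases "0 < b")
      case True
      then show ?thesis
        by (auto intro!: nn_integral_mono mult_right_mono power_mono open_dom_fun_le_dom_fun)
    qed simp
  qed
  also note dom
  finally show ?thesis
    unfolding eq by (simp add: ennreal_mult_less_top)
qed

text \<open>
  Dominated convergence for the difference quotients of the likelihood ratio.  The dominating
  function at a sample \<open>x\<close> is taken at \<open>a = mean\<close>, \<open>b = sd\<close>, since every observation \<open>x\<^sub>i\<close> lies in the
  interval over which the supremum extends.
\<close>

lemma prob_region_right_derivative:
  fixes R :: "(real^'n::finite) set"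
  assumes n: "2 \<le> CARD('n)" and \<epsilon>: "0 < \<epsilon>"
    and dom: "(\<integral>\<^sup>+b\<in>{0<..}. (\<integral>\<^sup>+a. dom_fun f CARD('n) \<epsilon> a b ^ CARD('n) *
        ennreal (exp (- real CARD('n) * (a\<^sup>2 + b\<^sup>2) / 2) * b ^ (CARD('n) - 2)) \<partial>lborel) \<partial>lborel) < \<infinity>"
    and score [measurable]: "score0 f \<in> borel_measurable borel"
    and R [measurable]: "R \<in> sets borel"
  shows "((\<lambda>\<theta>. (prob_region f \<theta> R - prob_region f 0 R) / \<theta>) \<longlongrightarrow>
      (\<integral>x. indicator R x * (\<Sum>i\<in>UNIV. score0 f (x $ i)) \<partial>std_normal_sample)) (at_right 0)"
proof -
  let ?P = "std_normal_sample :: (real^'n) measure"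
  let ?n = "CARD('n)"
  interpret P: prob_space ?P by (rule prob_space_std_normal_sample)
  let ?D = "\<lambda>x::real^'n. open_dom_fun f ?n \<epsilon> (sample_mean x) (sample_sd x)"
  define \<Gamma> where "\<Gamma> x = enn2real (?D x)" for x
  have [measurable]: "?D \<in> borel_measurable borel" by measurable
  have [measurable]: "\<Gamma> \<in> borel_measurable borel" unfolding \<Gamma>_def by measurable
  have \<Gamma>0: "0 \<le> \<Gamma> x" for x by (simp add: \<Gamma>_def)
  have fin: "(\<integral>\<^sup>+x. ?D x ^ ?n \<partial>?P) < \<infinity>" by (rule open_dom_fun_integrable[OF n dom])
  have AE_fin: "AE x in ?P. ?D x < \<infinity>"
  proof -
    have "AE x in ?P. ?D x ^ ?n \<noteq> \<infinity>"
      by (rule nn_integral_PInf_AE) (use fin in auto)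
    then show ?thesis
      by eventually_elim (auto simp: power_eq_top_ennreal less_top)
  qed
  have AE_sd: "AE x in ?P. 0 < sample_sd x"
    unfolding std_normal_sample_def using AE_sample_sd_pos[OF n]
    by (subst AE_density) auto
  let ?W = "\<lambda>x. (1 + \<epsilon> * \<Gamma> x) ^ ?n / \<epsilon>"
  have W: "integrable ?P ?W"
  proof (rule integrableI_nonneg)
    have "(\<integral>\<^sup>+x. ennreal (?W x) \<partial>?P) \<le> (\<integral>\<^sup>+x. ennreal (2 ^ ?n / \<epsilon>) * (1 + ennreal (\<epsilon> ^ ?n) * ?D x ^ ?n) \<partial>?P)"
    proof (rule nn_integral_mono)
      fix x :: "real^'n"
      have "(1 + \<epsilon> * \<Gamma> x) ^ ?n \<le> (2 * max 1 (\<epsilon> * \<Gamma> x)) ^ ?n"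
        by (rule power_mono) (use \<epsilon> \<Gamma>0[of x] in auto)
      also have "\<dots> \<le> 2 ^ ?n * (1 + (\<epsilon> * \<Gamma> x) ^ ?n)"
        using \<epsilon> \<Gamma>0[of x] by (auto simp: power_mult_distrib max_def)
      finally have "?W x \<le> 2 ^ ?n * (1 + (\<epsilon> * \<Gamma> x) ^ ?n) / \<epsilon>"
        using \<epsilon> by (simp add: divide_right_mono)
      also have "\<dots> = 2 ^ ?n / \<epsilon> * (1 + \<epsilon> ^ ?n * \<Gamma> x ^ ?n)" by (simp add: power_mult_distrib)
      finally have "ennreal (?W x) \<le> ennreal (2 ^ ?n / \<epsilon> * (1 + \<epsilon> ^ ?n * \<Gamma> x ^ ?n))"
        by (rule ennreal_leI)
      also have "\<dots> = ennreal (2 ^ ?n / \<epsilon>) * (1 + ennreal (\<epsilon> ^ ?n) * ennreal (\<Gamma> x) ^ ?n)"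
        using \<epsilon> \<Gamma>0[of x] unfolding ennreal_power[OF \<Gamma>0]
        by (intro ennreal_affine) auto
      also have "\<dots> \<le> ennreal (2 ^ ?n / \<epsilon>) * (1 + ennreal (\<epsilon> ^ ?n) * ?D x ^ ?n)"
        unfolding \<Gamma>_def
        by (intro mult_left_mono add_left_mono power_mono) (auto simp: ennreal_enn2real_if)
      finally show "ennreal (?W x) \<le> ennreal (2 ^ ?n / \<epsilon>) * (1 + ennreal (\<epsilon> ^ ?n) * ?D x ^ ?n)" .
    qed
    also have "\<dots> = ennreal (2 ^ ?n / \<epsilon>) * (1 + ennreal (\<epsilon> ^ ?n) * (\<integral>\<^sup>+x. ?D x ^ ?n \<partial>?P))"
      by (subst nn_integral_cmult, measurable, subst nn_integral_add, measurable, subst nn_integral_cmult, measurable)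
         (simp add: P.emeasure_space_1[simplified])
    also have "\<dots> < \<infinity>" using fin by (simp add: ennreal_mult_less_top)
    finally show "(\<integral>\<^sup>+x. ennreal (?W x) \<partial>?P) < \<infinity>" .
  qed (use \<epsilon> \<Gamma>0 in auto)
  \<comment> \<open>the absolute value makes the quotient measurable in x for negative \<open>\<theta>\<close> as well\<close>
  let ?s = "\<lambda>\<theta> x. indicator R x * ((joint_density f \<bar>\<theta>\<bar> x / joint_density f 0 x - 1) / \<theta>)"
  \<comment> \<open>the substitution \<open>\<theta> = 1 / t\<close> turns the right limit at 0 into a limit at infinity\<close>
  have "((\<lambda>t. integral\<^sup>L ?P (?s (inverse t))) \<longlongrightarrow>
      (\<integral>x. indicator R x * (\<Sum>i\<in>UNIV. score0 f (x $ i)) \<partial>?P)) at_top"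
  proof (rule integral_dominated_convergence_at_top[where w = ?W])
    show "(\<lambda>x. indicator R x * (\<Sum>i\<in>UNIV. score0 f (x $ i))) \<in> borel_measurable ?P" by measurable
    show "?s (inverse t) \<in> borel_measurable ?P" for t
    proof -
      have jd: "joint_density f \<theta> \<in> borel_measurable (borel :: (real^'n) measure)" if "0 \<le> \<theta>" for \<theta>
        by (rule borel_measurable_joint_density[where f = f and \<theta> = \<theta>, OF density_measurable[OF that]])
      have [measurable]: "joint_density f \<bar>inverse t\<bar> \<in> borel_measurable (borel :: (real^'n) measure)"
        "joint_density f 0 \<in> borel_measurable (borel :: (real^'n) measure)"
        by (rule jd; simp)+
      show ?thesis by measurable
    qed
    show "integrable ?P ?W" by (rule W)
    show "AE x in ?P. ((\<lambda>t. ?s (inverse t) x) \<longlongrightarrow> indicator R x * (\<Sum>i\<in>UNIV. score0 f (x $ i))) at_top"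
    proof (rule AE_I2)
      fix x :: "real^'n"
      have "((\<lambda>\<theta>. ?s \<theta> x) \<longlongrightarrow> indicator R x * (\<Sum>i\<in>UNIV. score0 f (x $ i))) (at_right 0)"
      proof (rule Lim_transform_eventually)
        show "((\<lambda>\<theta>. indicator R x * ((joint_density f \<theta> x / joint_density f 0 x - 1) / \<theta>)) \<longlongrightarrow>
            indicator R x * (\<Sum>i\<in>UNIV. score0 f (x $ i))) (at_right 0)"
          by (intro tendsto_mult tendsto_const joint_density_quotient_tendsto)
        show "\<forall>\<^sub>F \<theta> in at_right 0. indicator R x * ((joint_density f \<theta> x / joint_density f 0 x - 1) / \<theta>) = ?s \<theta> x"
          using eventually_at_right_less[of "0::real"] by eventually_elim simp
      qed
      then show "((\<lambda>t. ?s (inverse t) x) \<longlongrightarrow> indicator R x * (\<Sum>i\<in>UNIV. score0 f (x $ i))) at_top"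
        by (simp only: filterlim_at_right_to_top)
    qed
    show "\<forall>\<^sub>F t in at_top. AE x in ?P. norm (?s (inverse t) x) \<le> ?W x"
      using eventually_ge_at_top[of "inverse \<epsilon>"] eventually_gt_at_top[of 0]
    proof eventually_elim
      case (elim t)
      then have t: "0 < inverse t" "inverse t \<le> \<epsilon>"
        using \<epsilon> by (auto simp: field_simps)
      from AE_fin AE_sd show ?case
      proof eventually_elim
        case (elim x)
        have "\<bar>(joint_density f (inverse t) x / joint_density f 0 x - 1) / inverse t\<bar> \<le> ?W x"
        proof (rule joint_density_quotient_bound[OF t \<Gamma>0])
          fix i \<eta> assume \<eta>: "0 \<le> \<eta>" "\<eta> \<le> \<epsilon>"
          have "(x $ i, \<eta>) \<in> {y. \<bar>y - sample_mean x\<bar> < sample_sd x * sqrt (real ?n)} \<times> {0..\<epsilon>}"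
            using abs_deviation_less[OF elim(2)] \<eta> by auto
          from SUP_upper[OF this, of "\<lambda>(x, \<theta>). ennreal (\<bar>theta_deriv (f x) \<theta>\<bar> / f x 0)"]
          have "ennreal (\<bar>theta_deriv (f (x $ i)) \<eta>\<bar> / f (x $ i) 0) \<le> ?D x"
            by (simp add: open_dom_fun_def)
          also have "?D x = ennreal (\<Gamma> x)" using elim(1) by (simp add: \<Gamma>_def)
          finally show "\<bar>theta_deriv (f (x $ i)) \<eta>\<bar> / f (x $ i) 0 \<le> \<Gamma> x"
            using \<Gamma>0[of x] by (simp add: ennreal_le_iff)
        qed
        then show ?case using t \<epsilon> \<Gamma>0[of x] by (auto simp: indicator_def)
      qed
    qed
  qed
  then have "((\<lambda>\<theta>. integral\<^sup>L ?P (?s \<theta>)) \<longlongrightarrow>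
      (\<integral>x. indicator R x * (\<Sum>i\<in>UNIV. score0 f (x $ i)) \<partial>?P)) (at_right 0)"
    by (simp only: filterlim_at_right_to_top)
  then show ?thesis
  proof (rule Lim_transform_eventually)
    show "\<forall>\<^sub>F \<theta> in at_right 0. integral\<^sup>L ?P (?s \<theta>) = (prob_region f \<theta> R - prob_region f 0 R) / \<theta>"
      using eventually_at_right_less[of "0::real"]
    proof eventually_elim
      case (elim \<theta>)
      have j0: "joint_density f 0 x \<noteq> 0" for x :: "real^'n"
        using joint_density_pos[of 0 x] by simp
      have "(prob_region f \<theta> R - prob_region f 0 R) =
        (\<integral>x. indicator R x * (joint_density f \<theta> x / joint_density f 0 x) -
             indicator R x * (joint_density f 0 x / joint_density f 0 x) \<partial>?P)"
        using prob_region_eq_integral[OF less_imp_le[OF elim] R]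
          prob_region_eq_integral[OF order_refl R]
        by (simp only: Bochner_Integration.integral_diff)
      then show ?case
        using j0 elim by (simp add: algebra_simps divide_simps flip: Bochner_Integration.integral_divide_zero)
    qed
  qed
qed

end

end

section \<open>Expected score of an invariant region\<close>

text \<open>
  If the standard deviation is zero, both sides vanish.  Hence the moment identities below
  hold for all samples.
\<close>

lemma sd_times_standardized:
  "sample_sd x * standardized x i = x $ i - sample_mean x" for x :: "real^'n::finite"
proof (cases "sample_sd x = 0")
  case True
  then have "(\<Sum>j\<in>UNIV. (x $ j - sample_mean x)\<^sup>2) = 0"
    using sum_deviations_square[of x] by simp
  then have "\<forall>j\<in>UNIV. (x $ j - sample_mean x)\<^sup>2 = 0"
    by (subst (asm) sum_nonneg_eq_0_iff) auto
  then show ?thesis using True by simp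
qed (simp add: standardized_def)

lemma sum_deviations_power:
  "(\<Sum>i\<in>UNIV. (x $ i - sample_mean x) ^ k) = real CARD('n) * (sample_sd x ^ k * std_moment k x)"
  for x :: "real^'n::finite"
  by (simp add: sd_times_standardized[symmetric] power_mult_distrib std_moment_def sum_distrib_left[symmetric])

lemma sum_power_3_mean_sd:
  "(\<Sum>i\<in>UNIV. (x $ i) ^ 3) = real CARD('n) *
     (sample_mean x ^ 3 + 3 * sample_mean x * sample_sd x ^ 2 + sample_sd x ^ 3 * skewness x)"
  for x :: "real^'n::finite"
proof -
  let ?m = "sample_mean x"
  have "(\<Sum>i\<in>UNIV. (x $ i) ^ 3) = (\<Sum>i\<in>UNIV. (x $ i - ?m) ^ 3 + 3 * ?m * (x $ i - ?m)\<^sup>2 +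
      3 * ?m\<^sup>2 * (x $ i - ?m) + ?m ^ 3)"
    by (intro sum.cong) (auto simp: power2_eq_square power3_eq_cube algebra_simps)
  also have "\<dots> = real CARD('n) * (sample_sd x ^ 3 * skewness x) +
      3 * ?m * (real CARD('n) * (sample_sd x)\<^sup>2) + real CARD('n) * ?m ^ 3"
    by (simp only: sum.distrib sum_distrib_left[symmetric] sum_deviations sum_deviations_square
        sum_deviations_power) simp
  finally show ?thesis by (simp add: algebra_simps)
qed

lemma sum_power_4_mean_sd:
  "(\<Sum>i\<in>UNIV. (x $ i) ^ 4) = real CARD('n) *
     (sample_mean x ^ 4 + 6 * sample_mean x ^ 2 * sample_sd x ^ 2 +
      4 * sample_mean x * sample_sd x ^ 3 * skewness x + sample_sd x ^ 4 * kurtosis x)"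
  for x :: "real^'n::finite"
proof -
  let ?m = "sample_mean x"
  have "(\<Sum>i\<in>UNIV. (x $ i) ^ 4) = (\<Sum>i\<in>UNIV. (x $ i - ?m) ^ 4 + 4 * ?m * (x $ i - ?m) ^ 3 +
      6 * ?m\<^sup>2 * (x $ i - ?m)\<^sup>2 + 4 * ?m ^ 3 * (x $ i - ?m) + ?m ^ 4)"
    by (intro sum.cong) (auto simp: eval_nat_numeral algebra_simps)
  also have "\<dots> = real CARD('n) * (sample_sd x ^ 4 * kurtosis x) +
      4 * ?m * (real CARD('n) * (sample_sd x ^ 3 * skewness x)) +
      6 * ?m\<^sup>2 * (real CARD('n) * (sample_sd x)\<^sup>2) + real CARD('n) * ?m ^ 4"
    by (simp only: sum.distrib sum_distrib_left[symmetric] sum_deviations sum_deviations_square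
        sum_deviations_power) simp
  finally show ?thesis by (simp add: algebra_simps)
qed

lemma borel_measurable_std_moment [measurable]:
  "std_moment k \<in> borel_measurable (borel :: (real^'n::finite) measure)"
  unfolding std_moment_def[abs_def] standardized_def[abs_def] by measurable

lemma affine_invariant_std_moment: "affine_invariant (std_moment k :: real^'n::finite \<Rightarrow> real)"
proof -
  have "standardized (\<chi> j. a + b * x $ j) i = standardized x i" if "0 < b" for a b i and x :: "real^'n"
    using that
    by (simp add: standardized_def sample_mean_affine sample_sd_affine right_diff_distrib[symmetric])
  then show ?thesis by (simp add: affine_invariant_def std_moment_def)
qed

lemma integrable_std_moment:
  "integrable std_normal_sample (std_moment k :: real^'n::finite \<Rightarrow> real)"
proof -
  interpret P: prob_space "std_normal_sample :: (real^'n) measure" by (rule prob_space_std_normal_sample)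
  have z: "\<bar>standardized x i\<bar> \<le> sqrt (real CARD('n))" for x :: "real^'n" and i
  proof (cases "sample_sd x = 0")
    case False
    then have "0 < sample_sd x" using sample_sd_nonneg[of x] by simp
    then show ?thesis
      using abs_deviation_less[of x i] by (simp add: standardized_def abs_divide field_simps)
  qed (simp add: standardized_def)
  have "\<bar>std_moment k x\<bar> \<le> sqrt (real CARD('n)) ^ k" for x :: "real^'n"
  proof -
    have "\<bar>\<Sum>i\<in>UNIV. standardized x i ^ k\<bar> \<le> (\<Sum>i\<in>(UNIV::'n set). sqrt (real CARD('n)) ^ k)"
      by (rule order_trans[OF sum_abs], intro sum_mono) (auto simp: power_abs z intro: power_mono)
    then show ?thesis by (simp add: std_moment_def abs_divide field_simps)
  qed
  then show ?thesis
    by (intro P.integrable_const_bound[where B = "sqrt (real CARD('n)) ^ k"]) auto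
qed

lemma affine_invariant_indicator_mult:
  assumes "invariant_region R" "affine_invariant \<psi>"
  shows "affine_invariant (\<lambda>x. indicator R x * \<psi> x :: real)"
proof -
  have "(\<chi> i. a + b * x $ i) \<in> R \<longleftrightarrow> x \<in> R" if "0 < b" for a b x
    using assms(1)[unfolded invariant_region_def, THEN conjunct2, rule_format, OF that, of x a] by simp
  then show ?thesis
    using assms(2) by (simp add: affine_invariant_def indicator_def)
qed

lemma integrable_indicator_mult:
  fixes \<psi> :: "real^'n::finite \<Rightarrow> real"
  assumes "R \<in> sets borel" "integrable std_normal_sample \<psi>"
  shows "integrable std_normal_sample (\<lambda>x. indicator R x * \<psi> x)"
  using integrable_mult_indicator[of R std_normal_sample \<psi>] assms by simp

text \<open>
  A score of the form \<open>q\<^sub>0 + S q\<^sub>1 + T q\<^sub>2\<close> with \<open>q\<^sub>i\<close> depending on \<open>(mean, sd)\<close> and \<open>S\<close>, \<open>T\<close> invariant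
  has, by independence, an expectation over an invariant region that involves the region only
  through its probability and the expectation of \<open>S\<close>, provided that \<open>E q\<^sub>2 = 0\<close>.
\<close>

lemma expected_score_region:
  fixes h S T :: "real^'n::finite \<Rightarrow> real" and q0 q1 q2 :: "real \<Rightarrow> real \<Rightarrow> real"
  assumes n: "2 \<le> CARD('n)" and R: "invariant_region R"
    and S: "affine_invariant S" "integrable std_normal_sample S"
    and T: "affine_invariant T" "integrable std_normal_sample T"
    and m [measurable]: "case_prod q0 \<in> borel_measurable (borel \<Otimes>\<^sub>M borel)"
      "case_prod q1 \<in> borel_measurable (borel \<Otimes>\<^sub>M borel)"
      "case_prod q2 \<in> borel_measurable (borel \<Otimes>\<^sub>M borel)"
    and q: "integrable std_normal_sample (\<lambda>x::real^'n. q0 (sample_mean x) (sample_sd x))"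
      "integrable std_normal_sample (\<lambda>x::real^'n. q1 (sample_mean x) (sample_sd x))"
      "integrable std_normal_sample (\<lambda>x::real^'n. q2 (sample_mean x) (sample_sd x))"
    and q2: "(\<integral>x. q2 (sample_mean x) (sample_sd x) \<partial>(std_normal_sample :: (real^'n) measure)) = 0"
    and h: "\<And>x. h x = q0 (sample_mean x) (sample_sd x) + S x * q1 (sample_mean x) (sample_sd x) +
      T x * q2 (sample_mean x) (sample_sd x)"
  shows "(\<integral>x. indicator R x * h x \<partial>std_normal_sample) =
     (\<integral>x. q1 (sample_mean x) (sample_sd x) \<partial>(std_normal_sample :: (real^'n) measure)) *
       (\<integral>x. indicator R x * S x \<partial>std_normal_sample) +
     (\<integral>x. q0 (sample_mean x) (sample_sd x) \<partial>(std_normal_sample :: (real^'n) measure)) * measure std_normal_sample R"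
proof -
  let ?P = "std_normal_sample :: (real^'n) measure"
  interpret P: prob_space ?P by (rule prob_space_std_normal_sample)
  have Rb: "R \<in> sets borel" using R by (rule invariant_region_borel)
  have one: "affine_invariant (\<lambda>x::real^'n. 1 :: real)" by (simp add: affine_invariant_def)
  note ind = std_normal_sample_invariant_independent[OF n affine_invariant_indicator_mult[OF R]
      integrable_indicator_mult[OF Rb]]
  have i1: "integrable ?P (\<lambda>x. 1 :: real)" by simp
  note I0 = ind[OF one i1 m(1) q(1)] and I1 = ind[OF S m(2) q(2)] and I2 = ind[OF T m(3) q(3)]
  have "(\<integral>x. indicator R x * h x \<partial>?P) = (\<integral>x. (indicator R x * 1) * q0 (sample_mean x) (sample_sd x) +
      (indicator R x * S x) * q1 (sample_mean x) (sample_sd x) +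
      (indicator R x * T x) * q2 (sample_mean x) (sample_sd x) \<partial>?P)"
    by (intro Bochner_Integration.integral_cong) (auto simp: h algebra_simps)
  also have "\<dots> = (\<integral>x. indicator R x * 1 \<partial>?P) * (\<integral>x. q0 (sample_mean x) (sample_sd x) \<partial>?P) +
      (\<integral>x. indicator R x * S x \<partial>?P) * (\<integral>x. q1 (sample_mean x) (sample_sd x) \<partial>?P) +
      (\<integral>x. indicator R x * T x \<partial>?P) * (\<integral>x. q2 (sample_mean x) (sample_sd x) \<partial>?P)"
    using I0 I1 I2 by (simp only: Bochner_Integration.integral_add Bochner_Integration.integrable_add)
  also have "(\<integral>x. indicator R x * 1 \<partial>?P) = measure ?P R" by simp
  finally show ?thesis by (simp add: q2 mult.commute)
qed

lemma expected_sd_power_pos: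
  assumes "2 \<le> CARD('n::finite)"
  shows "0 < (\<integral>x. sample_sd x ^ k \<partial>(std_normal_sample :: (real^'n) measure))"
proof -
  let ?P = "std_normal_sample :: (real^'n) measure"
  interpret P: prob_space ?P by (rule prob_space_std_normal_sample)
  have AE_sd: "AE x in ?P. 0 < sample_sd x"
    unfolding std_normal_sample_def using AE_sample_sd_pos[OF assms] by (subst AE_density) auto
  have int: "integrable ?P (\<lambda>x. sample_sd x ^ k)"
    using integrable_mean_sd_monomial[of 0 k] by simp
  have "(\<integral>x. sample_sd x ^ k \<partial>?P) \<noteq> 0"
  proof
    assume "(\<integral>x. sample_sd x ^ k \<partial>?P) = 0"
    then have "AE x in ?P. sample_sd x ^ k = 0"
      using integral_nonneg_eq_0_iff_AE[OF int] by (simp add: sample_sd_nonneg)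
    with AE_sd have "AE x in ?P. False" by eventually_elim simp
    then show False by simp
  qed
  moreover have "0 \<le> (\<integral>x. sample_sd x ^ k \<partial>?P)"
    by (rule integral_nonneg_AE) (simp add: sample_sd_nonneg)
  ultimately show ?thesis by simp
qed

text \<open>
  In \<open>\<Sum> l(m + s z\<^sub>i)\<close> the relations \<open>\<Sum> z\<^sub>i = 0\<close> and \<open>\<Sum> z\<^sub>i\<^sup>2 = n\<close> leave the skewness as the only
  quantity that depends on the shape of the sample; its coefficient is \<open>n c\<^sub>3 s\<^sup>3\<close>.
\<close>

lemma expected_score_cubic:
  fixes l :: "real poly"
  assumes n: "2 \<le> CARD('n::finite)" and l: "degree l = 3"
  obtains \<alpha> \<beta> where "0 < \<alpha>" "\<And>R. invariant_region R \<Longrightarrow>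
    (\<integral>x. indicator R x * (\<Sum>i\<in>UNIV. poly l (x $ i)) \<partial>(std_normal_sample :: (real^'n) measure)) =
    lead_coeff l * \<alpha> * (\<integral>x. indicator R x * skewness x \<partial>std_normal_sample) + \<beta> * measure std_normal_sample R"
proof -
  let ?P = "std_normal_sample :: (real^'n) measure"
  let ?n = "real CARD('n)"
  let ?c = "coeff l"
  let ?q0 = "\<lambda>m s. ?n * ?c 0 + ?n * ?c 1 * (m ^ 1 * s ^ 0) + ?n * ?c 2 * (m ^ 2 * s ^ 0) + ?n * ?c 2 * (m ^ 0 * s ^ 2)
    + ?n * ?c 3 * (m ^ 3 * s ^ 0) + 3 * ?n * ?c 3 * (m ^ 1 * s ^ 2)"
  let ?q1 = "\<lambda>m s::real. ?n * ?c 3 * (m ^ 0 * s ^ 3)"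
  interpret P: prob_space ?P by (rule prob_space_std_normal_sample)
  have h: "(\<Sum>i\<in>UNIV. poly l (x $ i)) = ?q0 (sample_mean x) (sample_sd x) +
      skewness x * ?q1 (sample_mean x) (sample_sd x) + skewness x * (\<lambda>m s. 0) (sample_mean x) (sample_sd x)"
    for x :: "real^'n"
  proof -
    have "(\<Sum>i\<in>UNIV. poly l (x $ i)) = (\<Sum>i\<in>UNIV. ?c 0 + ?c 1 * (x $ i) + ?c 2 * (x $ i)\<^sup>2 + ?c 3 * (x $ i) ^ 3)"
      by (simp add: poly_altdef l eval_nat_numeral)
    also have "\<dots> = ?n * ?c 0 + ?c 1 * (?n * sample_mean x) +
        ?c 2 * (\<Sum>i\<in>UNIV. (x $ i)\<^sup>2) + ?c 3 * (\<Sum>i\<in>UNIV. (x $ i) ^ 3)"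
      by (simp add: sum.distrib sum_distrib_left[symmetric] sample_mean_def)
    finally show ?thesis
      unfolding sum_squares_mean_sd sum_power_3_mean_sd by (simp add: algebra_simps)
  qed
  let ?\<alpha> = "?n * (\<integral>x. sample_sd x ^ 3 \<partial>?P)"
  let ?\<beta> = "\<integral>x. ?q0 (sample_mean x) (sample_sd x) \<partial>?P"
  have "(\<integral>x. indicator R x * (\<Sum>i\<in>UNIV. poly l (x $ i)) \<partial>?P) =
    lead_coeff l * ?\<alpha> * (\<integral>x. indicator R x * skewness x \<partial>?P) + ?\<beta> * measure ?P R"
    if R: "invariant_region R" for R
  proof -
    have m: "case_prod ?q0 \<in> borel_measurable (borel \<Otimes>\<^sub>M borel)"
      "case_prod ?q1 \<in> borel_measurable (borel \<Otimes>\<^sub>M borel)"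
      "case_prod (\<lambda>m s. 0 :: real) \<in> borel_measurable (borel \<Otimes>\<^sub>M borel)"
      by measurable
    have int: "integrable ?P (\<lambda>x. ?q0 (sample_mean x) (sample_sd x))"
      "integrable ?P (\<lambda>x. ?q1 (sample_mean x) (sample_sd x))"
      "integrable ?P (\<lambda>x. (\<lambda>m s. 0 :: real) (sample_mean x) (sample_sd x))"
      by (intro Bochner_Integration.integrable_add integrable_mult_right P.integrable_const
          integrable_mean_sd_monomial)+
    have q2: "(\<integral>x. (\<lambda>m s. 0 :: real) (sample_mean x) (sample_sd x) \<partial>?P) = 0" by simp
    have "(\<integral>x. indicator R x * (\<Sum>i\<in>UNIV. poly l (x $ i)) \<partial>?P) =
      (\<integral>x. ?q1 (sample_mean x) (sample_sd x) \<partial>?P) * (\<integral>x. indicator R x * skewness x \<partial>?P) + ?\<beta> * measure ?P R"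
      by (rule expected_score_region[where ?q0.0 = ?q0 and ?q1.0 = ?q1 and ?q2.0 = "\<lambda>m s. 0" and T = skewness,
            OF n R affine_invariant_std_moment integrable_std_moment
            affine_invariant_std_moment integrable_std_moment m int q2 h])
    then show ?thesis by (simp add: l)
  qed
  moreover have "0 < ?\<alpha>" using expected_sd_power_pos[OF n, of 3] by simp
  ultimately show ?thesis using that by blast
qed

text \<open>
  Expanding \<open>(m + s z\<^sub>i)\<^sup>4\<close> brings in the skewness as well, with coefficient \<open>4 n c\<^sub>4 m s\<^sup>3\<close>.  This
  coefficient is odd in the mean and has expectation zero, so only the kurtosis term
  remains.
\<close>

lemma expected_score_even_quartic:
  fixes l :: "real poly"
  assumes n: "2 \<le> CARD('n::finite)" and l: "degree l = 4" and even: "\<And>k. odd k \<Longrightarrow> coeff l k = 0"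
  obtains \<alpha> \<beta> where "0 < \<alpha>" "\<And>R. invariant_region R \<Longrightarrow>
    (\<integral>x. indicator R x * (\<Sum>i\<in>UNIV. poly l (x $ i)) \<partial>(std_normal_sample :: (real^'n) measure)) =
    lead_coeff l * \<alpha> * (\<integral>x. indicator R x * kurtosis x \<partial>std_normal_sample) + \<beta> * measure std_normal_sample R"
proof -
  let ?P = "std_normal_sample :: (real^'n) measure"
  let ?n = "real CARD('n)"
  let ?c = "coeff l"
  let ?q0 = "\<lambda>m s. ?n * ?c 0 + ?n * ?c 2 * (m ^ 2 * s ^ 0) + ?n * ?c 2 * (m ^ 0 * s ^ 2)
    + ?n * ?c 4 * (m ^ 4 * s ^ 0) + 6 * ?n * ?c 4 * (m ^ 2 * s ^ 2)"
  let ?q1 = "\<lambda>m s::real. ?n * ?c 4 * (m ^ 0 * s ^ 4)"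
  let ?q2 = "\<lambda>m s::real. 4 * ?n * ?c 4 * (m ^ 1 * s ^ 3)"
  interpret P: prob_space ?P by (rule prob_space_std_normal_sample)
  have h: "(\<Sum>i\<in>UNIV. poly l (x $ i)) = ?q0 (sample_mean x) (sample_sd x) +
      kurtosis x * ?q1 (sample_mean x) (sample_sd x) + skewness x * ?q2 (sample_mean x) (sample_sd x)"
    for x :: "real^'n"
  proof -
    have "{..4::nat} = {0, 1, 2, 3, 4}" by auto
    then have "(\<Sum>i\<in>UNIV. poly l (x $ i)) = (\<Sum>i\<in>UNIV. ?c 0 + ?c 2 * (x $ i)\<^sup>2 + ?c 4 * (x $ i) ^ 4)"
      by (simp add: poly_altdef l even add.assoc)
    also have "\<dots> = ?n * ?c 0 + ?c 2 * (\<Sum>i\<in>UNIV. (x $ i)\<^sup>2) + ?c 4 * (\<Sum>i\<in>UNIV. (x $ i) ^ 4)"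
      by (simp add: sum.distrib sum_distrib_left[symmetric])
    finally show ?thesis
      unfolding sum_squares_mean_sd sum_power_4_mean_sd by (simp add: algebra_simps)
  qed
  let ?\<alpha> = "?n * (\<integral>x. sample_sd x ^ 4 \<partial>?P)"
  let ?\<beta> = "\<integral>x. ?q0 (sample_mean x) (sample_sd x) \<partial>?P"
  have "(\<integral>x. indicator R x * (\<Sum>i\<in>UNIV. poly l (x $ i)) \<partial>?P) =
    lead_coeff l * ?\<alpha> * (\<integral>x. indicator R x * kurtosis x \<partial>?P) + ?\<beta> * measure ?P R"
    if R: "invariant_region R" for R
  proof -
    have m: "case_prod ?q0 \<in> borel_measurable (borel \<Otimes>\<^sub>M borel)"
      "case_prod ?q1 \<in> borel_measurable (borel \<Otimes>\<^sub>M borel)"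
      "case_prod ?q2 \<in> borel_measurable (borel \<Otimes>\<^sub>M borel)"
      by measurable
    have int: "integrable ?P (\<lambda>x. ?q0 (sample_mean x) (sample_sd x))"
      "integrable ?P (\<lambda>x. ?q1 (sample_mean x) (sample_sd x))"
      "integrable ?P (\<lambda>x. ?q2 (sample_mean x) (sample_sd x))"
      by (intro Bochner_Integration.integrable_add integrable_mult_right P.integrable_const
          integrable_mean_sd_monomial)+
    have q2: "(\<integral>x. ?q2 (sample_mean x) (sample_sd x) \<partial>?P) = 0"
      using integral_mean_sd_odd[of 1 3, where 'n = 'n] by simp
    have "(\<integral>x. indicator R x * (\<Sum>i\<in>UNIV. poly l (x $ i)) \<partial>?P) =
      (\<integral>x. ?q1 (sample_mean x) (sample_sd x) \<partial>?P) * (\<integral>x. indicator R x * kurtosis x \<partial>?P) + ?\<beta> * measure ?P R"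
      by (rule expected_score_region[where ?q0.0 = ?q0 and ?q1.0 = ?q1 and ?q2.0 = ?q2 and T = skewness,
            OF n R affine_invariant_std_moment integrable_std_moment
            affine_invariant_std_moment integrable_std_moment m int q2 h])
    then show ?thesis by (simp add: l)
  qed
  moreover have "0 < ?\<alpha>" using expected_sd_power_pos[OF n, of 4] by simp
  ultimately show ?thesis using that by blast
qed

section \<open>The local Neyman-Pearson argument\<close>

text \<open>
  If \<open>R'\<close> has smaller size than \<open>R\<close>, then by continuity at \<open>0\<close> it also has smaller power nearby.
  If the sizes agree, the derivatives of the power functions differ by a positive multiple of
  \<open>E[(1\<^sub>R - 1\<^sub>R\<^sub>') (S - c)]\<close>, whose integrand is nonnegative as in the Neyman-Pearson lemma.  This
  expectation is either positive, so that \<open>R\<close> wins for small \<open>\<theta>\<close>, or zero, in which case the two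
  regions coincide almost everywhere and have the same power for all \<open>\<theta>\<close>.
\<close>

lemma lbi_region_superlevel:
  fixes f :: "real \<Rightarrow> real \<Rightarrow> real" and S :: "real^'n::finite \<Rightarrow> real"
  assumes smooth: "smooth_density_family f"
    and null: "\<And>x. f x 0 = 1 / sqrt (2 * pi) * exp (- x\<^sup>2 / 2)"
    and S: "affine_invariant S" "integrable std_normal_sample S" and \<alpha>: "0 < \<alpha>"
    and deriv: "\<And>R :: (real^'n) set. invariant_region R \<Longrightarrow>
      ((\<lambda>\<theta>. (prob_region f \<theta> R - prob_region f 0 R) / \<theta>) \<longlongrightarrow>
        \<alpha> * (\<integral>x. indicator R x * S x \<partial>std_normal_sample) + \<beta> * measure std_normal_sample R) (at_right 0)"
  shows "lbi_region f {x. c < S x}"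
proof -
  let ?P = "std_normal_sample :: (real^'n) measure"
  interpret P: prob_space ?P by (rule prob_space_std_normal_sample)
  have Sm: "S \<in> borel_measurable borel" using borel_measurable_integrable[OF S(2)] by simp
  define R where "R = {x. c < S x}"
  have R: "invariant_region R"
    using invariant_region_vimage[OF S(1) Sm, of "{c<..}"] by (simp add: R_def)
  have prob0: "prob_region f 0 A = measure ?P A" if "A \<in> sets borel" for A :: "(real^'n) set"
  proof -
    have "joint_density f 0 x \<noteq> 0" for x :: "real^'n"
      using joint_density_pos[OF smooth order_refl, of x] by simp
    then show ?thesis
      using prob_region_eq_integral(1)[OF smooth null order_refl that] that by simp
  qed
  have "\<exists>\<theta>\<^sub>0>0. \<forall>\<theta>. 0 < \<theta> \<and> \<theta> < \<theta>\<^sub>0 \<longrightarrow> prob_region f \<theta> R' \<le> prob_region f \<theta> R"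
    if R': "invariant_region R'" and size: "prob_region f 0 R' \<le> prob_region f 0 R" for R' :: "(real^'n) set"
  proof -
    note Rb = invariant_region_borel[OF R] and R'b = invariant_region_borel[OF R']
    let ?E = "\<lambda>A. \<integral>x. indicator A x * S x \<partial>?P"
    let ?d = "\<lambda>\<theta>. prob_region f \<theta> R - prob_region f \<theta> R'"
    let ?D = "\<alpha> * (?E R - ?E R') + \<beta> * (measure ?P R - measure ?P R')"
    have quot: "(prob_region f \<theta> R - prob_region f 0 R) / \<theta> -
        (prob_region f \<theta> R' - prob_region f 0 R') / \<theta> = (?d \<theta> - ?d 0) / \<theta>" for \<theta>
      by (simp add: diff_divide_distrib)
    have D: "\<alpha> * ?E R + \<beta> * measure ?P R - (\<alpha> * ?E R' + \<beta> * measure ?P R') = ?D"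
      by (simp add: algebra_simps)
    have lim: "((\<lambda>\<theta>. (?d \<theta> - ?d 0) / \<theta>) \<longlongrightarrow> ?D) (at_right 0)"
      using tendsto_diff[OF deriv[OF R] deriv[OF R']] unfolding quot D .
    have "\<forall>\<^sub>F \<theta> in at_right 0. 0 \<le> ?d \<theta>"
    proof (cases "prob_region f 0 R' = prob_region f 0 R")
      case False
      have "((\<lambda>\<theta>. ?d 0 + \<theta> * ((?d \<theta> - ?d 0) / \<theta>)) \<longlongrightarrow> ?d 0 + 0 * ?D) (at_right 0)"
        by (intro tendsto_add tendsto_const tendsto_mult lim tendsto_ident_at)
      moreover have "0 < ?d 0 + 0 * ?D" using False size by simp
      ultimately have "\<forall>\<^sub>F \<theta> in at_right 0. 0 < ?d 0 + \<theta> * ((?d \<theta> - ?d 0) / \<theta>)"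
        by (rule order_tendstoD(1))
      then show ?thesis
        using eventually_at_right_less[of "0::real"] by eventually_elim auto
    next
      case True
      have mR: "measure ?P R = measure ?P R'" using True prob0[OF Rb] prob0[OF R'b] by simp
      let ?g = "\<lambda>x. (indicator R x - indicator R' x) * (S x - c)"
      have g0: "0 \<le> ?g x" for x by (auto simp: R_def indicator_def)
      have "integrable ?P (\<lambda>x. indicator R x * (S x - c))" "integrable ?P (\<lambda>x. indicator R' x * (S x - c))"
        by (intro integrable_indicator_mult Rb R'b Bochner_Integration.integrable_diff S P.integrable_const)+
      then have gi: "integrable ?P ?g" by (simp add: left_diff_distrib)
      have "(\<integral>x. ?g x \<partial>?P) = (\<integral>x. (indicator R x * S x - indicator R' x * S x) -
          c * (indicator R x - indicator R' x) \<partial>?P)"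
        by (intro Bochner_Integration.integral_cong) (auto simp: algebra_simps)
      also have "\<dots> = (?E R - ?E R') - c * (measure ?P R - measure ?P R')"
        using integrable_indicator_mult[OF Rb S(2)] integrable_indicator_mult[OF R'b S(2)] Rb R'b
        by (simp add: P.emeasure_eq_measure)
      finally have gE: "(\<integral>x. ?g x \<partial>?P) = ?E R - ?E R'" using mR by simp
      show ?thesis
      proof (cases "(\<integral>x. ?g x \<partial>?P) = 0")
        case False
        moreover have "0 \<le> (\<integral>x. ?g x \<partial>?P)" by (rule Bochner_Integration.integral_nonneg) (rule g0)
        ultimately have "0 < (\<integral>x. ?g x \<partial>?P)" by linarith
        then have "0 < ?D" using gE mR \<alpha> by simp
        with lim have "\<forall>\<^sub>F \<theta> in at_right 0. 0 < (?d \<theta> - ?d 0) / \<theta>" by (rule order_tendstoD(1))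
        then show ?thesis
          using eventually_at_right_less[of "0::real"]
          by eventually_elim (use True in \<open>auto simp: zero_less_divide_iff\<close>)
      next
        case zero: True
        have "AE x in ?P. ?g x = 0"
          using integral_nonneg_eq_0_iff_AE[OF gi] g0 zero by simp
        \<comment> \<open>on \<open>R - R'\<close> the factor \<open>S - c\<close> is strictly positive, so this difference is a null set\<close>
        then have sub: "AE x in ?P. x \<in> R \<longrightarrow> x \<in> R'"
          by eventually_elim (auto simp: R_def indicator_def split: if_splits)
        \<comment> \<open>equality of the sizes then forces \<open>R' - R\<close> to be a null set too\<close>
        have "(\<integral>x. indicator R' x - indicator R x \<partial>?P) = measure ?P R' - measure ?P R"
          using Rb R'b by (simp add: P.emeasure_eq_measure)
        then have "(\<integral>x. indicator R' x - indicator R x \<partial>?P) = (0::real)" using mR by simp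
        moreover have "AE x in ?P. 0 \<le> (indicator R' x - indicator R x :: real)"
          using sub by eventually_elim (auto simp: indicator_def)
        moreover have "integrable ?P (\<lambda>x. indicator R' x - indicator R x :: real)"
          using Rb R'b by (simp add: P.emeasure_eq_measure)
        ultimately have "AE x in ?P. indicator R' x - indicator R x = (0::real)"
          using integral_nonneg_eq_0_iff_AE by blast
        then have eq: "AE x in ?P. indicator R' x = (indicator R x :: real)"
          by eventually_elim simp
        have "prob_region f \<theta> R' = prob_region f \<theta> R" if \<theta>: "0 < \<theta>" for \<theta>
        proof -
          note I = prob_region_eq_integral[OF smooth null less_imp_le[OF \<theta>]]
          show ?thesis
            unfolding I(1)[OF Rb] I(1)[OF R'b]
            by (rule integral_cong_AE)
               (use borel_measurable_integrable[OF I(2)[OF Rb]] borel_measurable_integrable[OF I(2)[OF R'b]] eq in auto)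
        qed
        then show ?thesis
          using eventually_at_right_less[of "0::real"] by (auto elim: eventually_mono)
      qed
    qed
    then show ?thesis unfolding eventually_at_right_field by auto
  qed
  then show ?thesis using R unfolding lbi_region_def R_def by blast
qed

text \<open>
  A negative leading coefficient is reduced to the positive case by replacing \<open>S\<close> with \<open>-S\<close>.
\<close>

lemma lbi_test_given_by_statistic:
  fixes f :: "real \<Rightarrow> real \<Rightarrow> real" and S :: "real^'n::finite \<Rightarrow> real"
  assumes n: "2 \<le> CARD('n)" and smooth: "smooth_density_family f"
    and null: "\<And>x. f x 0 = 1 / sqrt (2 * pi) * exp (- x\<^sup>2 / 2)"
    and \<epsilon>: "0 < \<epsilon>"
    and dom: "(\<integral>\<^sup>+b\<in>{0<..}. (\<integral>\<^sup>+a. dom_fun f CARD('n) \<epsilon> a b ^ CARD('n) *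
        ennreal (exp (- real CARD('n) * (a\<^sup>2 + b\<^sup>2) / 2) * b ^ (CARD('n) - 2)) \<partial>lborel) \<partial>lborel) < \<infinity>"
    and score: "\<And>x. score0 f x = poly l x"
    and S: "affine_invariant S" "integrable std_normal_sample S" and \<alpha>: "0 < \<alpha>"
    and E: "\<And>R. invariant_region R \<Longrightarrow>
      (\<integral>x. indicator R x * (\<Sum>i\<in>UNIV. poly l (x $ i)) \<partial>(std_normal_sample :: (real^'n) measure)) =
      lead_coeff l * \<alpha> * (\<integral>x. indicator R x * S x \<partial>std_normal_sample) + \<beta> * measure std_normal_sample R"
  shows "lbi_test_given_by f l S"
proof -
  have "score0 f = poly l" using score by auto
  moreover have "poly l \<in> borel_measurable borel"
    by (intro borel_measurable_continuous_onI continuous_intros)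
  ultimately have m: "score0 f \<in> borel_measurable borel" by simp
  have deriv: "((\<lambda>\<theta>. (prob_region f \<theta> R - prob_region f 0 R) / \<theta>) \<longlongrightarrow>
      lead_coeff l * \<alpha> * (\<integral>x. indicator R x * S x \<partial>std_normal_sample) + \<beta> * measure std_normal_sample R) (at_right 0)"
    if R: "invariant_region R" for R :: "(real^'n) set"
    using prob_region_right_derivative[OF smooth null n \<epsilon> dom m invariant_region_borel[OF R]] E[OF R]
    by (simp add: score)
  show ?thesis unfolding lbi_test_given_by_def
  proof (intro allI conjI impI)
    fix c assume "0 < lead_coeff l"
    then show "lbi_region f {x. S x > c}"
      using \<alpha> by (intro lbi_region_superlevel[OF smooth null S _ deriv]) auto
  next
    fix c assume "lead_coeff l < 0"
    then have pos: "0 < - (lead_coeff l * \<alpha>)" using \<alpha> by (simp add: mult_neg_pos)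
    have S': "affine_invariant (\<lambda>x. - S x)" "integrable std_normal_sample (\<lambda>x. - S x)"
      using S by (auto simp: affine_invariant_def)
    have "lbi_region f {x. - c < - S x}"
      by (rule lbi_region_superlevel[OF smooth null S' pos]) (use deriv in simp)
    then show "lbi_region f {x. S x < c}" by simp
  qed
qed

theorem corollary1:
  fixes f :: "real \<Rightarrow> real \<Rightarrow> real"
  assumes "CARD('n::finite) \<ge> 3"
    and "smooth_density_family f"
    and "\<And>x. f x 0 = 1 / sqrt (2 * pi) * exp (- x\<^sup>2 / 2)"
    and "\<exists>\<epsilon>>0. (\<integral>\<^sup>+b\<in>{0<..}. (\<integral>\<^sup>+a. dom_fun f CARD('n) \<epsilon> a b ^ CARD('n) *
           ennreal (exp (- real CARD('n) * (a\<^sup>2 + b\<^sup>2) / 2) * b ^ (CARD('n) - 2)) \<partial>lborel) \<partial>lborel) < \<infinity>"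
  shows "(\<forall>l :: real poly. (\<forall>x. score0 f x = poly l x) \<and> degree l = 3 \<longrightarrow>
            lbi_test_given_by f l (skewness :: real^'n \<Rightarrow> real)) \<and>
         (\<forall>l :: real poly. (\<forall>x. score0 f x = poly l x) \<and> degree l = 4 \<and> (\<forall>k. odd k \<longrightarrow> coeff l k = 0) \<longrightarrow>
            lbi_test_given_by f l (kurtosis :: real^'n \<Rightarrow> real))"
proof -
  have n: "2 \<le> CARD('n)" using assms(1) by simp
  obtain \<epsilon> where \<epsilon>: "0 < \<epsilon>" and dom: "(\<integral>\<^sup>+b\<in>{0<..}. (\<integral>\<^sup>+a. dom_fun f CARD('n) \<epsilon> a b ^ CARD('n) *
        ennreal (exp (- real CARD('n) * (a\<^sup>2 + b\<^sup>2) / 2) * b ^ (CARD('n) - 2)) \<partial>lborel) \<partial>lborel) < \<infinity>"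
    using assms(4) by blast
  note given_by = lbi_test_given_by_statistic[OF n assms(2,3) \<epsilon> dom _
      affine_invariant_std_moment integrable_std_moment]
  show ?thesis
  proof (intro conjI allI impI; elim conjE)
    fix l :: "real poly"
    assume score: "\<forall>x. score0 f x = poly l x" and "degree l = 3"
    then obtain \<alpha> \<beta> where "0 < \<alpha>" "\<And>R. invariant_region R \<Longrightarrow>
        (\<integral>x. indicator R x * (\<Sum>i\<in>UNIV. poly l (x $ i)) \<partial>(std_normal_sample :: (real^'n) measure)) =
        lead_coeff l * \<alpha> * (\<integral>x. indicator R x * skewness x \<partial>std_normal_sample) + \<beta> * measure std_normal_sample R"
      using expected_score_cubic[OF n] by blast
    then show "lbi_test_given_by f l (skewness :: real^'n \<Rightarrow> real)"
      by (rule given_by[OF score[rule_format]])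
  next
    fix l :: "real poly"
    assume score: "\<forall>x. score0 f x = poly l x" and "degree l = 4" "\<forall>k. odd k \<longrightarrow> coeff l k = 0"
    then obtain \<alpha> \<beta> where "0 < \<alpha>" "\<And>R. invariant_region R \<Longrightarrow>
        (\<integral>x. indicator R x * (\<Sum>i\<in>UNIV. poly l (x $ i)) \<partial>(std_normal_sample :: (real^'n) measure)) =
        lead_coeff l * \<alpha> * (\<integral>x. indicator R x * kurtosis x \<partial>std_normal_sample) + \<beta> * measure std_normal_sample R"
      using expected_score_even_quartic[OF n] by blast
    then show "lbi_test_given_by f l (kurtosis :: real^'n \<Rightarrow> real)"
      by (rule given_by[OF score[rule_format]])
  qed
qed

end
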